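(* Constrained Connectivity-Sum with symmetric and hierarchical safe sets can be solved optimally in polynomial time.
   Context: Constrained Connectivity-Sum: given a graph $G=(V,E)$ and for each pair $(u,v)\in V\times V$ a safe set $S(u,v)\subseteq V$ with $u,v\in S(u,v)$, find a subgraph $H$ of $G$ with the minimum number of edges such that for every pair $(u,v)$, $H$ contains a $u$–$v$ path all of whose vertices lie in $S(u,v)$. The safe sets are symmetric if $S(x,y)=S(y,x)$ for all $x,y\in V$, and hierarchical if for all $x,y,z\in V$, $z\in S(x,y)$ implies $S(x,z)\subseteq S(x,y)$ and $S(z,y)\subseteq S(x,y)$. The underlying graph $G$ is arbitrary. *)

theory Defs
  imports "HOL-Computational_Algebra.Polynomial"
begin

section \<open>Graphs and paths\<close>

type_synonym 'a ugraph = "'a set \<times> 'a set set"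

definition is_graph :: "'a ugraph \<Rightarrow> bool" where
  "is_graph G \<longleftrightarrow> finite (fst G) \<and> (\<forall>e\<in>snd G. e \<subseteq> fst G \<and> card e = 2)"

definition subgraph :: "'a ugraph \<Rightarrow> 'a ugraph \<Rightarrow> bool" where
  "subgraph H G \<longleftrightarrow> is_graph H \<and> fst H \<subseteq> fst G \<and> snd H \<subseteq> snd G"

definition is_path :: "'a ugraph \<Rightarrow> 'a \<Rightarrow> 'a list \<Rightarrow> 'a \<Rightarrow> bool" where
  "is_path G u xs v \<longleftrightarrow>
     xs \<noteq> [] \<and> hd xs = u \<and> last xs = v \<and> distinct xs \<and> set xs \<subseteq> fst G \<and>
     successively (\<lambda>x y. {x, y} \<in> snd G) xs"


section \<open>Constrained connectivity\<close>

definition safe_sets :: "'a set \<Rightarrow> ('a \<Rightarrow> 'a \<Rightarrow> 'a set) \<Rightarrow> bool" where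
  "safe_sets V S \<longleftrightarrow> (\<forall>u\<in>V. \<forall>v\<in>V. u \<in> S u v \<and> v \<in> S u v \<and> S u v \<subseteq> V)"

definition symmetric_on :: "'a set \<Rightarrow> ('a \<Rightarrow> 'a \<Rightarrow> 'a set) \<Rightarrow> bool" where
  "symmetric_on V S \<longleftrightarrow> (\<forall>x\<in>V. \<forall>y\<in>V. S x y = S y x)"

definition hierarchical_on :: "'a set \<Rightarrow> ('a \<Rightarrow> 'a \<Rightarrow> 'a set) \<Rightarrow> bool" where
  "hierarchical_on V S \<longleftrightarrow>
     (\<forall>x\<in>V. \<forall>y\<in>V. \<forall>z\<in>V. z \<in> S x y \<longrightarrow> S x z \<subseteq> S x y \<and> S z y \<subseteq> S x y)"

definition feasible :: "'a ugraph \<Rightarrow> ('a \<Rightarrow> 'a \<Rightarrow> 'a set) \<Rightarrow> 'a ugraph \<Rightarrow> bool" where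
  "feasible G S H \<longleftrightarrow> subgraph H G \<and>
     (\<forall>u\<in>fst G. \<forall>v\<in>fst G. \<exists>xs. is_path H u xs v \<and> set xs \<subseteq> S u v)"

definition optimal :: "'a ugraph \<Rightarrow> ('a \<Rightarrow> 'a \<Rightarrow> 'a set) \<Rightarrow> 'a ugraph \<Rightarrow> bool" where
  "optimal G S H \<longleftrightarrow> is_arg_min (\<lambda>H. card (snd H)) (feasible G S) H"

lemma feasible_spanning:
  assumes "feasible G S H"
  shows "fst H = fst G"
proof
  show "fst H \<subseteq> fst G"
    using assms by (auto simp: feasible_def subgraph_def)
  show "fst G \<subseteq> fst H"
  proof
    fix u assume "u \<in> fst G"
    then obtain xs where "is_path H u xs u"
      using assms unfolding feasible_def by blast
    then show "u \<in> fst H"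
      unfolding is_path_def using hd_in_set by blast
  qed
qed


section \<open>Random access machines\<close>

text \<open>
  The machine has registers and a random access memory, all holding natural numbers.
  Every operation costs one unit.  The only arithmetic is addition and truncated
  subtraction, so within \<open>t\<close> steps on a binary input of length \<open>l\<close> a fixed program only
  produces numbers of \<open>O(t + log l)\<close> bits.  Hence the unit-cost measure is
  polynomially related to Turing machine time.
\<close>

datatype expr = Const nat | Reg nat | Mem expr | Add expr expr | Sub expr expr

datatype prog =
    Skip
  | Assign nat expr
  | Store expr expr  \<comment> \<open>address, value\<close>
  | Seq prog prog
  | If expr prog prog
  | While expr prog

type_synonym state = "(nat \<Rightarrow> nat) \<times> (nat \<Rightarrow> nat)"  \<comment> \<open>registers, memory\<close>

fun expr_val :: "expr \<Rightarrow> state \<Rightarrow> nat" where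
  "expr_val (Const k) s = k"
| "expr_val (Reg r) s = fst s r"
| "expr_val (Mem a) s = snd s (expr_val a s)"
| "expr_val (Add a b) s = expr_val a s + expr_val b s"
| "expr_val (Sub a b) s = expr_val a s - expr_val b s"

fun expr_cost :: "expr \<Rightarrow> nat" where
  "expr_cost (Const k) = 1"
| "expr_cost (Reg r) = 1"
| "expr_cost (Mem a) = expr_cost a + 1"
| "expr_cost (Add a b) = expr_cost a + expr_cost b + 1"
| "expr_cost (Sub a b) = expr_cost a + expr_cost b + 1"

text \<open>\<open>exec c s t s'\<close>: started in \<open>s\<close>, the program \<open>c\<close> halts in \<open>s'\<close> after exactly \<open>t\<close> steps.
  Conditions are true iff nonzero.\<close>

inductive exec :: "prog \<Rightarrow> state \<Rightarrow> nat \<Rightarrow> state \<Rightarrow> bool" where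
  Skip: "exec Skip s 1 s"
| Assign: "exec (Assign r a) s (expr_cost a + 1) ((fst s)(r := expr_val a s), snd s)"
| Store: "exec (Store a b) s (expr_cost a + expr_cost b + 1)
            (fst s, (snd s)(expr_val a s := expr_val b s))"
| Seq: "exec c1 s t1 s' \<Longrightarrow> exec c2 s' t2 s'' \<Longrightarrow> exec (Seq c1 c2) s (t1 + t2) s''"
| IfTrue: "expr_val b s \<noteq> 0 \<Longrightarrow> exec c1 s t s' \<Longrightarrow>
            exec (If b c1 c2) s (expr_cost b + 1 + t) s'"
| IfFalse: "expr_val b s = 0 \<Longrightarrow> exec c2 s t s' \<Longrightarrow>
            exec (If b c1 c2) s (expr_cost b + 1 + t) s'"
| WhileFalse: "expr_val b s = 0 \<Longrightarrow> exec (While b c) s (expr_cost b + 1) s"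
| WhileTrue: "expr_val b s \<noteq> 0 \<Longrightarrow> exec c s t1 s' \<Longrightarrow> exec (While b c) s' t2 s'' \<Longrightarrow>
            exec (While b c) s (expr_cost b + 1 + t1 + t2) s''"

inductive_cases exec_SkipE: "exec Skip s t s'"
inductive_cases exec_AssignE: "exec (Assign r a) s t s'"
inductive_cases exec_StoreE: "exec (Store a b) s t s'"
inductive_cases exec_SeqE: "exec (Seq c1 c2) s t s'"
inductive_cases exec_IfE: "exec (If b c1 c2) s t s'"
inductive_cases exec_WhileE: "exec (While b c) s t s'"

lemma exec_deterministic:
  "exec c s t s' \<Longrightarrow> exec c s u s'' \<Longrightarrow> u = t \<and> s'' = s'"
proof (induction arbitrary: u s'' rule: exec.induct)
  case (Skip s)
  then show ?case by (auto elim: exec_SkipE)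
next
  case (Assign r a s)
  then show ?case by (auto elim: exec_AssignE)
next
  case (Store a b s)
  then show ?case by (auto elim: exec_StoreE)
next
  case (Seq c1 s t1 s1 c2 t2 s2)
  from Seq.prems obtain u1 u2 r where r: "exec c1 s u1 r" "exec c2 r u2 s''" and u: "u = u1 + u2"
    by (rule exec_SeqE)
  have 1: "u1 = t1 \<and> r = s1" by (rule Seq.IH(1)) (fact r)
  have 2: "u2 = t2 \<and> s'' = s2" by (rule Seq.IH(2)) (use r 1 in simp)
  show ?case using 1 2 u by simp
next
  case (IfTrue b s c1 t s' c2)
  from IfTrue.prems obtain u1 where u1: "exec c1 s u1 s''" and u: "u = expr_cost b + 1 + u1"
    by (rule exec_IfE) (use IfTrue.hyps(1) in simp_all)
  have "u1 = t \<and> s'' = s'" by (rule IfTrue.IH) (fact u1)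
  then show ?case using u by simp
next
  case (IfFalse b s c2 t s' c1)
  from IfFalse.prems obtain u1 where u1: "exec c2 s u1 s''" and u: "u = expr_cost b + 1 + u1"
    by (rule exec_IfE) (use IfFalse.hyps(1) in simp_all)
  have "u1 = t \<and> s'' = s'" by (rule IfFalse.IH) (fact u1)
  then show ?case using u by simp
next
  case (WhileFalse b s c)
  from WhileFalse.prems show ?case
    by (rule exec_WhileE) (use WhileFalse.hyps in simp_all)
next
  case (WhileTrue b s c t1 s1 t2 s2)
  from WhileTrue.prems obtain u1 u2 r
    where r: "exec c s u1 r" "exec (While b c) r u2 s''" and u: "u = expr_cost b + 1 + u1 + u2"
  proof (rule exec_WhileE)
    assume "expr_val b s = 0"
    then show thesis using WhileTrue.hyps(1) by simp
  qed simp
  have 1: "u1 = t1 \<and> r = s1" by (rule WhileTrue.IH(1)) (fact r)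
  have 2: "u2 = t2 \<and> s'' = s2" by (rule WhileTrue.IH(2)) (use r 1 in simp)
  show ?case using 1 2 u by simp
qed

text \<open>Input and output are bit strings, stored in memory from address 0 on, with their length
  in register 0; all other registers and memory cells are initially 0.\<close>

definition input_state :: "bool list \<Rightarrow> state" where
  "input_state x = ((\<lambda>r. if r = 0 then length x else 0),
                    (\<lambda>i. if i < length x then of_bool (x ! i) else 0))"

definition output_of :: "state \<Rightarrow> bool list \<Rightarrow> bool" where
  "output_of s y \<longleftrightarrow> fst s 0 = length y \<and> (\<forall>i<length y. snd s i = of_bool (y ! i))"

definition runs :: "prog \<Rightarrow> bool list \<Rightarrow> nat \<Rightarrow> bool list \<Rightarrow> bool" where
  "runs c x t y \<longleftrightarrow> (\<exists>s. exec c (input_state x) t s \<and> output_of s y)"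

text \<open>A search problem is given by a set \<open>I\<close> of instances, a binary encoding of them, and the
  relation between instances and correct answers.  Inputs that do not encode a member of \<open>I\<close>
  impose no requirement.\<close>

definition poly_time_solvable ::
  "'i set \<Rightarrow> ('i \<Rightarrow> bool list) \<Rightarrow> ('i \<Rightarrow> bool list \<Rightarrow> bool) \<Rightarrow> bool" where
  "poly_time_solvable I enc answer \<longleftrightarrow>
     (\<exists>c. \<exists>p :: nat poly. \<forall>i\<in>I. \<exists>t y.
        runs c (enc i) t y \<and> t \<le> poly p (length (enc i)) \<and> answer i y)"


section \<open>Constrained Connectivity-Sum as a search problem\<close>

text \<open>An instance \<open>(n, E, S)\<close> consists of the graph \<open>({..<n}, E)\<close> and its safe sets \<open>S\<close>.\<close>

type_synonym cc_instance = "nat \<times> nat set set \<times> (nat \<Rightarrow> nat \<Rightarrow> nat set)"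

definition sym_hier_instances :: "cc_instance set" where
  "sym_hier_instances = {(n, E, S).
     is_graph ({..<n}, E) \<and> safe_sets {..<n} S \<and>
     symmetric_on {..<n} S \<and> hierarchical_on {..<n} S}"

definition adj_bits :: "nat \<Rightarrow> nat set set \<Rightarrow> bool list" where
  "adj_bits n E = [{u, v} \<in> E. u \<leftarrow> [0..<n], v \<leftarrow> [0..<n]]"

definition safe_bits :: "nat \<Rightarrow> (nat \<Rightarrow> nat \<Rightarrow> nat set) \<Rightarrow> bool list" where
  "safe_bits n S = [w \<in> S u v. u \<leftarrow> [0..<n], v \<leftarrow> [0..<n], w \<leftarrow> [0..<n]]"

text \<open>The number of vertices is written in unary, followed by the adjacency matrix and the
  membership bits of all safe sets, each in row-major order.\<close>

definition cc_encode :: "cc_instance \<Rightarrow> bool list" where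
  "cc_encode = (\<lambda>(n, E, S). replicate n True @ [False] @ adj_bits n E @ safe_bits n S)"

text \<open>Since the graph is arbitrary there may be no feasible subgraph at all; the answer is then
  the single bit \<open>False\<close>.  Otherwise it is \<open>True\<close> followed by the adjacency matrix of an optimal
  subgraph, which determines the subgraph by \<open>feasible_spanning\<close>.\<close>

definition cc_sum_answer :: "cc_instance \<Rightarrow> bool list \<Rightarrow> bool" where
  "cc_sum_answer = (\<lambda>(n, E, S) y.
     if \<exists>H. feasible ({..<n}, E) S H
     then \<exists>H. optimal ({..<n}, E) S H \<and> y = True # adj_bits n (snd H)
     else y = [False])"

end

(* For a safe set A = S(x,y) let R(A) consist of the pairs p, q in A with S(p,q) a proper subset
   of A. If p, q in A are not joined by R(A), the hierarchy and symmetry axioms force S(p,q) = A,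
   so an edge that joins different components of R(A) does so for only one A. A subgraph is feasible
   iff it is connected on every A, hence for each A it needs at least (number of components of
   R(A) on A) - 1 edges with safe set A. Processing the edges uv of G by increasing |S(u,v)|, and
   adding uv iff u and v are not yet connected inside S(u,v), attains this bound for all A
   simultaneously. Connectivity inside all the safe sets is maintained by component labels. *)

theory Submission
  imports Defs
begin

section \<open>For-loop programs\<close>

text \<open>The order by size matters because a pair in R(A) has a safe set with fewer elements than
  A. If any feasible subgraph exists, such pairs are already joined inside A when the edges with
  safe set A come up. So whatever R(A) and the edges chosen for A join is joined inside A; an
  accepted edge, whose ends are not, merges two components of that relation. That the pairs in R(A)
  are joined is not evident from the edges processed: it is proved by replacing, one by one, the
  edges of a hypothetical feasible subgraph. Infeasible instances admit no such argument, so the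
  result is checked at the end; a failed check is conclusive, as the greedy result is feasible
  whenever anything is.

  The other obstacle is the step count of a while program. The algorithm is written in a loop
  language where each loop runs n times and a polynomial bound is read off the syntax; n itself is
  parsed from its unary form by a separate while loop.\<close>

datatype loop_prog =
    LSkip
  | LAssign nat expr
  | LStore expr expr
  | LSeq loop_prog loop_prog
  | LIf expr loop_prog loop_prog
  | LFor nat loop_prog

text \<open>A loop runs its counter up to the value of register 1, which no loop body may modify
  (\<open>well_formed\<close>). Hence the running time is a polynomial in that value.\<close>

fun compile :: "loop_prog \<Rightarrow> prog" where
  "compile LSkip = Skip"
| "compile (LAssign r a) = Assign r a"
| "compile (LStore a b) = Store a b"
| "compile (LSeq c d) = Seq (compile c) (compile d)"
| "compile (LIf b c d) = If b (compile c) (compile d)"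
| "compile (LFor i c) = Seq (Assign i (Const 0))
     (While (Sub (Reg 1) (Reg i)) (Seq (compile c) (Assign i (Add (Reg i) (Const 1)))))"

definition set_reg :: "nat \<Rightarrow> nat \<Rightarrow> state \<Rightarrow> state" where
  "set_reg r k s = ((fst s)(r := k), snd s)"

text \<open>Total, because a loop reads its number of iterations from register 1 on entry. The
  counter is incremented from its current value, as in the compiled code, so agreement with
  \<open>compile\<close> depends on bodies leaving the counter and register 1 alone.\<close>

fun sem :: "loop_prog \<Rightarrow> state \<Rightarrow> state" where
  "sem LSkip s = s"
| "sem (LAssign r a) s = set_reg r (expr_val a s) s"
| "sem (LStore a b) s = (fst s, (snd s)(expr_val a s := expr_val b s))"
| "sem (LSeq c d) s = sem d (sem c s)"
| "sem (LIf b c d) s = (if expr_val b s \<noteq> 0 then sem c s else sem d s)"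
| "sem (LFor i c) s =
     ((\<lambda>s. let s' = sem c s in set_reg i (fst s' i + 1) s') ^^ fst s 1) (set_reg i 0 s)"

fun mods :: "loop_prog \<Rightarrow> nat set" where
  "mods LSkip = {}"
| "mods (LAssign r a) = {r}"
| "mods (LStore a b) = {}"
| "mods (LSeq c d) = mods c \<union> mods d"
| "mods (LIf b c d) = mods c \<union> mods d"
| "mods (LFor i c) = insert i (mods c)"

text \<open>In a sequence only the first part must preserve register 1: the bound for the second
  part is taken at the value found when it starts.\<close>

fun well_formed :: "loop_prog \<Rightarrow> bool" where
  "well_formed (LSeq c d) = (well_formed c \<and> well_formed d \<and> 1 \<notin> mods c)"
| "well_formed (LIf b c d) = (well_formed c \<and> well_formed d)"
| "well_formed (LFor i c) = (well_formed c \<and> i \<notin> mods c \<and> 1 \<notin> mods c \<and> i \<noteq> 1)"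
| "well_formed _ = True"

text \<open>Clearing a counter takes 2 steps, each test of the guard 4 and each increment 4: hence 6
  once and 8 per iteration besides the body. A conditional is charged for both branches, since a
  maximum of polynomials need not be one.\<close>

fun time_poly :: "loop_prog \<Rightarrow> nat poly" where
  "time_poly LSkip = [:1:]"
| "time_poly (LAssign r a) = [:expr_cost a + 1:]"
| "time_poly (LStore a b) = [:expr_cost a + expr_cost b + 1:]"
| "time_poly (LSeq c d) = time_poly c + time_poly d"
| "time_poly (LIf b c d) = [:expr_cost b + 1:] + time_poly c + time_poly d"
| "time_poly (LFor i c) = pCons 6 (time_poly c + [:8:])"

lemma fst_set_reg [simp]: "fst (set_reg r k s) x = (if x = r then k else fst s x)"
  by (simp add: set_reg_def)

lemma snd_set_reg [simp]: "snd (set_reg r k s) = snd s"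
  by (simp add: set_reg_def)

lemma sem_unmodified: "r \<notin> mods c \<Longrightarrow> fst (sem c s) r = fst s r"
proof (induction c arbitrary: s)
  case (LFor i c)
  have "fst (((\<lambda>s. let s' = sem c s in set_reg i (fst s' i + 1) s') ^^ m) s') r = fst s' r" for m s'
    by (induction m) (use LFor in \<open>auto simp: Let_def\<close>)
  then show ?case using LFor.prems by simp
qed auto

text \<open>Invariant rule for loops. The step is handed the counter value and all unmodified
  registers, so invariants need only mention what changes.\<close>

lemma sem_LFor_induct:
  assumes wf: "well_formed (LFor i c)" and n: "fst s 1 = n"
    and base: "P 0 (set_reg i 0 s)"
    and step: "\<And>k s'. k < n \<Longrightarrow> fst s' i = k \<Longrightarrow>
      (\<And>r. r \<notin> mods (LFor i c) \<Longrightarrow> fst s' r = fst s r) \<Longrightarrow> P k s' \<Longrightarrow> P (Suc k) (set_reg i (Suc k) (sem c s'))"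
  shows "P n (sem (LFor i c) s)"
proof -
  let ?f = "\<lambda>s. let s' = sem c s in set_reg i (fst s' i + 1) s'"
  have "P m ((?f ^^ m) (set_reg i 0 s)) \<and> fst ((?f ^^ m) (set_reg i 0 s)) i = m
     \<and> (\<forall>r. r \<notin> mods (LFor i c) \<longrightarrow> fst ((?f ^^ m) (set_reg i 0 s)) r = fst s r)" if "m \<le> n" for m
    using that
  proof (induction m)
    case 0
    then show ?case using wf n base by auto
  next
    case (Suc m)
    then show ?case using step[of m "(?f ^^ m) (set_reg i 0 s)"] wf
      by (auto simp: Let_def sem_unmodified)
  qed
  then show ?thesis using n by simp
qed

text \<open>Simulation form of the loop rule, with \<open>P b s'\<close> read as: \<open>s'\<close>
  represents \<open>b\<close>. Nested loops then match nested folds.\<close>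

lemma sem_LFor_fold:
  assumes "well_formed (LFor i c)" "fst s 1 = n" "P a (set_reg i 0 s)"
    and "\<And>k b s'. k < n \<Longrightarrow> fst s' i = k \<Longrightarrow>
      (\<And>r. r \<notin> mods (LFor i c) \<Longrightarrow> fst s' r = fst s r) \<Longrightarrow> P b s' \<Longrightarrow>
      P (f k b) (set_reg i (Suc k) (sem c s'))"
  shows "P (fold f [0..<n] a) (sem (LFor i c) s)"
  using sem_LFor_induct[of i c s n "\<lambda>k. P (fold f [0..<k] a)"] assms by simp

lemma compile_correct:
  "well_formed c \<Longrightarrow> \<exists>t. exec (compile c) s t (sem c s) \<and> t \<le> poly (time_poly c) (fst s 1)"
proof (induction c arbitrary: s)
  case LSkip
  show ?case by (auto intro: exec.Skip)
next
  case (LAssign r a)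
  show ?case by (auto simp: set_reg_def intro!: exI exec.Assign)
next
  case (LStore a b)
  show ?case by (auto intro!: exI exec.Store)
next
  case (LSeq c d)
  from LSeq obtain t where t: "exec (compile c) s t (sem c s)" "t \<le> poly (time_poly c) (fst s 1)"
    by fastforce
  from LSeq obtain t' where "exec (compile d) (sem c s) t' (sem d (sem c s))"
    "t' \<le> poly (time_poly d) (fst (sem c s) 1)"
    by fastforce
  then show ?case using t LSeq.prems
    by (auto simp: sem_unmodified intro!: exI[of _ "t + t'"] exec.Seq)
next
  case (LIf b c d)
  show ?case
  proof (cases "expr_val b s = 0")
    case True
    from LIf obtain t where "exec (compile d) s t (sem d s)" "t \<le> poly (time_poly d) (fst s 1)"
      by fastforce
    then show ?thesis using True
      by (auto intro!: exI[of _ "expr_cost b + 1 + t"] exec.IfFalse)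
  next
    case False
    from LIf obtain t where "exec (compile c) s t (sem c s)" "t \<le> poly (time_poly c) (fst s 1)"
      by fastforce
    then show ?thesis using False
      by (auto intro!: exI[of _ "expr_cost b + 1 + t"] exec.IfTrue)
  qed
next
  case (LFor i c)
  let ?f = "\<lambda>s. let s' = sem c s in set_reg i (fst s' i + 1) s'"
  let ?w = "While (Sub (Reg 1) (Reg i)) (Seq (compile c) (Assign i (Add (Reg i) (Const 1))))"
  let ?p = "poly (time_poly c)"
  \<comment> \<open>Induction on the number \<open>m\<close> of remaining iterations, for all states
    since the body changes them; the 4 pays for the last, failing test.\<close>
  have loop: "\<exists>t. exec ?w s' t ((?f ^^ m) s') \<and> t \<le> 4 + m * (8 + ?p (fst s' 1))"
    if "fst s' 1 - fst s' i = m" for m s'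
    using that
  proof (induction m arbitrary: s')
    case 0
    have "exec ?w s' (expr_cost (Sub (Reg 1) (Reg i)) + 1) s'"
      by (rule exec.WhileFalse) (use 0 in simp)
    then show ?case by (auto intro!: exI)
  next
    case (Suc m)
    from LFor obtain t where t: "exec (compile c) s' t (sem c s')" "t \<le> ?p (fst s' 1)"
      by fastforce
    have inv: "fst (sem c s') i = fst s' i" "fst (sem c s') 1 = fst s' 1"
      using LFor.prems by (auto simp: sem_unmodified)
    have "exec (Assign i (Add (Reg i) (Const 1))) (sem c s') 4 (?f s')"
      using exec.Assign[of i "Add (Reg i) (Const 1)" "sem c s'"]
      by (simp add: Let_def set_reg_def numeral_eq_Suc)
    with t have body: "exec (Seq (compile c) (Assign i (Add (Reg i) (Const 1)))) s' (t + 4) (?f s')"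
      by (blast intro: exec.Seq)
    have "fst (?f s') 1 - fst (?f s') i = m" "fst (?f s') 1 = fst s' 1"
      using Suc.prems inv LFor.prems by (auto simp: Let_def)
    with Suc.IH[of "?f s'"] obtain t' where t': "exec ?w (?f s') t' ((?f ^^ m) (?f s'))"
      "t' \<le> 4 + m * (8 + ?p (fst s' 1))"
      by auto
    have "exec ?w s' (expr_cost (Sub (Reg 1) (Reg i)) + 1 + (t + 4) + t') ((?f ^^ m) (?f s'))"
      by (rule exec.WhileTrue[OF _ body t'(1)]) (use Suc.prems in simp)
    moreover have "expr_cost (Sub (Reg 1) (Reg i)) + 1 + (t + 4) + t' \<le> 4 + Suc m * (8 + ?p (fst s' 1))"
      using t(2) t'(2) by simp
    ultimately show ?case unfolding funpow_Suc_right comp_apply by blast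
  qed
  obtain t where t: "exec ?w (set_reg i 0 s) t (sem (LFor i c) s)"
    "t \<le> 4 + fst s 1 * (8 + ?p (fst s 1))"
    using loop[of "set_reg i 0 s" "fst s 1"] LFor.prems by auto
  have "exec (Assign i (Const 0)) s 2 (set_reg i 0 s)"
    using exec.Assign[of i "Const 0" s] by (simp add: set_reg_def numeral_eq_Suc)
  with t(1) have "exec (compile (LFor i c)) s (2 + t) (sem (LFor i c) s)"
    unfolding compile.simps by (meson exec.Seq)
  then show ?case using t(2) by (intro exI[of _ "2 + t"]) (simp add: algebra_simps)
qed

lemma poly_mono_nat: "a \<le> b \<Longrightarrow> poly p a \<le> poly p (b :: nat)"
  by (induction p) (auto intro!: add_mono mult_mono)

section \<open>Connected components\<close>

text \<open>Labels are demanded on all of \<open>V\<close> even if \<open>r\<close> lives on a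
  subset; the vertices outside are components of their own.\<close>

definition labelling :: "'a set \<Rightarrow> 'a rel \<Rightarrow> ('a \<Rightarrow> 'b) \<Rightarrow> bool" where
  "labelling V r l \<longleftrightarrow> (\<forall>a\<in>V. \<forall>b\<in>V. l a = l b \<longleftrightarrow> (a, b) \<in> r\<^sup>*)"

definition relabel :: "'a \<Rightarrow> 'a \<Rightarrow> ('a \<Rightarrow> 'b) \<Rightarrow> 'a \<Rightarrow> 'b" where
  "relabel u v l w = (if l w = l u then l v else l w)"

definition num_components :: "'a set \<Rightarrow> 'a rel \<Rightarrow> nat" where
  "num_components V r = card ((\<lambda>x. r\<^sup>* `` {x}) ` V)"

text \<open>On \<open>V\<close>, the map \<open>l'\<close> factors through \<open>l\<close>, by way
  of representatives chosen with \<open>inv_into\<close>.\<close>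

lemma card_image_le_refine:
  assumes "finite V" "\<And>a b. a \<in> V \<Longrightarrow> b \<in> V \<Longrightarrow> l a = l b \<Longrightarrow> l' a = l' b"
  shows "card (l' ` V) \<le> card (l ` V)"
proof -
  have "l' ` V \<subseteq> (\<lambda>z. l' (inv_into V l z)) ` l ` V"
  proof
    fix z assume "z \<in> l' ` V"
    then obtain a where a: "a \<in> V" "z = l' a" by auto
    have "l' (inv_into V l (l a)) = l' a"
      using a by (intro assms(2)) (auto intro: inv_into_into f_inv_into_f)
    with a show "z \<in> (\<lambda>z. l' (inv_into V l z)) ` l ` V" by force
  qed
  then show ?thesis
    by (rule surj_card_le[OF finite_imageI[OF assms(1)]])
qed

lemma labelling_classes:
  assumes "sym r"
  shows "labelling V r (\<lambda>x. r\<^sup>* `` {x})"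
proof -
  have "(r\<^sup>* `` {a} = r\<^sup>* `` {b}) \<longleftrightarrow> (a, b) \<in> r\<^sup>*" for a b
  proof
    assume "(a, b) \<in> r\<^sup>*"
    moreover from this have "(b, a) \<in> r\<^sup>*" using sym_rtrancl[OF assms] by (auto dest: symD)
    ultimately show "r\<^sup>* `` {a} = r\<^sup>* `` {b}" by (auto intro: rtrancl_trans)
  qed auto
  then show ?thesis by (simp add: labelling_def)
qed

lemma num_components_labelling:
  assumes "finite V" "sym r" "labelling V r l"
  shows "num_components V r = card (l ` V)"
  unfolding num_components_def
  using labelling_classes[OF assms(2), of V] assms(3) unfolding labelling_def
  by (intro antisym card_image_le_refine[OF assms(1)]) blast+

text \<open>A walk can be shortened to use the new edge at most once, in one of two directions. This
  gives three cases of reachability, and moving the class of \<open>u\<close> into that of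
  \<open>v\<close> matches them.\<close>

lemma labelling_relabel:
  assumes "labelling V r l" "sym r" "u \<in> V" "v \<in> V"
  shows "labelling V (insert (u, v) (insert (v, u) r)) (relabel u v l)"
proof -
  have s: "(a, b) \<in> r\<^sup>* \<longleftrightarrow> (b, a) \<in> r\<^sup>*" for a b
    using sym_rtrancl[OF assms(2)] by (auto dest: symD)
  have "(a, b) \<in> (insert (u, v) (insert (v, u) r))\<^sup>* \<longleftrightarrow>
     (a, b) \<in> r\<^sup>* \<or> (a, u) \<in> r\<^sup>* \<and> (v, b) \<in> r\<^sup>* \<or> (a, v) \<in> r\<^sup>* \<and> (u, b) \<in> r\<^sup>*" for a b
    unfolding rtrancl_insert by (auto intro: rtrancl_trans)
  then show ?thesis using assms(1,3,4) unfolding labelling_def relabel_def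
    by (smt (verit) s)
qed

text \<open>Two distinct classes merge: relabelling removes exactly the old label of
  \<open>u\<close> from the image.\<close>

lemma num_components_insert_new:
  assumes "finite V" "sym r" "u \<in> V" "v \<in> V" "(u, v) \<notin> r\<^sup>*"
  shows "num_components V r = Suc (num_components V (insert (u, v) (insert (v, u) r)))"
proof -
  let ?l = "\<lambda>x. r\<^sup>* `` {x}"
  have l: "labelling V r ?l" by (rule labelling_classes[OF assms(2)])
  have ne: "?l u \<noteq> ?l v" using l assms unfolding labelling_def by blast
  have "sym (insert (u, v) (insert (v, u) r))" using assms(2) by (auto simp: sym_def)
  then have "num_components V (insert (u, v) (insert (v, u) r)) = card (relabel u v ?l ` V)"
    by (rule num_components_labelling[OF assms(1) _ labelling_relabel[OF l assms(2-4)]])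
  also have "relabel u v ?l ` V = ?l ` V - {?l u}"
    using ne assms(3,4) unfolding relabel_def by (auto simp: image_iff)
  finally show ?thesis unfolding num_components_def
    using assms(1,3) by (metis (no_types, lifting) card_Suc_Diff1 finite_imageI imageI)
qed

text \<open>Inclusion in the closure, rather than in \<open>q\<close>, allows relations with
  unrelated generators to be compared.\<close>

lemma num_components_antimono:
  assumes "finite V" "sym r" "sym q" "r \<subseteq> q\<^sup>*"
  shows "num_components V q \<le> num_components V r"
proof -
  have "r\<^sup>* \<subseteq> q\<^sup>*" using rtrancl_subset_rtrancl[OF assms(4)] .
  then show ?thesis unfolding num_components_def
    using labelling_classes[OF assms(2), of V] labelling_classes[OF assms(3), of V]
    unfolding labelling_def by (intro card_image_le_refine[OF assms(1)]) blast
qed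

lemma num_components_insert_le:
  assumes "finite V" "sym r" "u \<in> V" "v \<in> V"
  shows "num_components V r \<le> Suc (num_components V (insert (u, v) (insert (v, u) r)))"
proof (cases "(u, v) \<in> r\<^sup>*")
  case True
  then have "(v, u) \<in> r\<^sup>*" using sym_rtrancl[OF assms(2)] by (auto dest: symD)
  with True have "num_components V r \<le> num_components V (insert (u, v) (insert (v, u) r))"
    using assms(1,2) by (intro num_components_antimono) (auto simp: sym_def)
  then show ?thesis by simp
next
  case False
  then show ?thesis using num_components_insert_new[OF assms] by simp
qed

section \<open>Edge relations, induced subgraphs and paths\<close>

definition adj :: "'a set set \<Rightarrow> 'a rel" where
  "adj F = {(p, q). {p, q} \<in> F}"

definition adj_in :: "'a set set \<Rightarrow> 'a set \<Rightarrow> 'a rel" where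
  "adj_in F A = {(p, q). p \<in> A \<and> q \<in> A \<and> {p, q} \<in> F}"

lemma sym_adj: "sym (adj F)"
  by (auto simp: adj_def sym_def insert_commute)

lemma sym_adj_in: "sym (adj_in F A)"
  by (auto simp: adj_in_def sym_def insert_commute)

lemma adj_insert: "adj (insert {u, v} F) = insert (u, v) (insert (v, u) (adj F))"
  by (auto simp: adj_def doubleton_eq_iff)

lemma adj_in_insert:
  "adj_in (insert {u, v} F) A =
     (if u \<in> A \<and> v \<in> A then insert (u, v) (insert (v, u) (adj_in F A)) else adj_in F A)"
  by (auto simp: adj_in_def doubleton_eq_iff)

lemma adj_in_mono: "F \<subseteq> F' \<Longrightarrow> A \<subseteq> A' \<Longrightarrow> (adj_in F A)\<^sup>* \<subseteq> (adj_in F' A')\<^sup>*"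
  by (intro rtrancl_mono) (auto simp: adj_in_def)

text \<open>Source of the lower bound on edges: one edge lowers the number of components by at most
  one.\<close>

lemma num_components_adj_le:
  assumes "finite V" "finite F" "sym r" "\<forall>e\<in>F. e \<subseteq> V \<and> card e = 2"
  shows "num_components V r \<le> num_components V (r \<union> adj F) + card F"
  using assms(2,4)
proof (induction F rule: finite_induct)
  case empty
  then show ?case by (simp add: adj_def)
next
  case (insert e F)
  then obtain u v where e: "e = {u, v}" "u \<in> V" "v \<in> V"
    by (metis card_2_iff insert_subset insertI1)
  have "sym (r \<union> adj F)" using assms(3) sym_adj by (rule sym_Un)
  from num_components_insert_le[OF assms(1) this e(2,3)]
  have "num_components V (r \<union> adj F) \<le> Suc (num_components V (r \<union> adj (insert e F)))"
    by (simp add: e(1) adj_insert)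
  with insert show ?case by auto
qed

text \<open>Reachability yields a walk, whereas \<open>is_path\<close> asks for distinct vertices;
  so the list is cut back whenever a vertex recurs.\<close>

lemma rtrancl_imp_path:
  assumes "(u, v) \<in> (adj_in F A)\<^sup>*" "u \<in> A" "A \<subseteq> V"
  shows "\<exists>xs. is_path (V, F) u xs v \<and> set xs \<subseteq> A"
  using assms(1)
proof (induction rule: rtrancl_induct)
  case base
  show ?case by (rule exI[of _ "[u]"]) (use assms(2,3) in \<open>auto simp: is_path_def\<close>)
next
  case (step y z)
  then obtain xs where xs: "is_path (V, F) u xs y" "set xs \<subseteq> A" by blast
  have z: "z \<in> A" "{y, z} \<in> F" using step.hyps by (auto simp: adj_in_def)
  show ?case
  proof (cases "z \<in> set xs")
    case True
    then obtain ys zs where ys: "xs = ys @ z # zs" by (meson split_list)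
    have "successively (\<lambda>x y. {x, y} \<in> F) ((ys @ [z]) @ zs)"
      using xs(1) by (simp add: is_path_def ys)
    then have "successively (\<lambda>x y. {x, y} \<in> F) (ys @ [z])"
      unfolding successively_append_iff by blast
    then have "is_path (V, F) u (ys @ [z]) z"
      using xs(1) unfolding is_path_def ys by (cases ys) auto
    then show ?thesis using xs(2) ys by (intro exI[of _ "ys @ [z]"]) auto
  next
    case False
    then have "is_path (V, F) u (xs @ [z]) z"
      using xs z assms(3) unfolding is_path_def by (auto simp: successively_append_iff)
    then show ?thesis using xs(2) z by (intro exI[of _ "xs @ [z]"]) auto
  qed
qed

lemma path_imp_rtrancl:
  assumes "is_path (V, F) u xs v" "set xs \<subseteq> A"
  shows "(u, v) \<in> (adj_in F A)\<^sup>*"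
proof -
  have "xs \<noteq> [] \<Longrightarrow> set xs \<subseteq> A \<Longrightarrow> successively (\<lambda>x y. {x, y} \<in> F) xs \<Longrightarrow>
    (hd xs, last xs) \<in> (adj_in F A)\<^sup>*"
  proof (induction xs)
    case (Cons x xs)
    show ?case
    proof (cases xs)
      case (Cons y ys)
      then have "(x, y) \<in> adj_in F A" using Cons.prems by (auto simp: adj_in_def)
      moreover have "(y, last xs) \<in> (adj_in F A)\<^sup>*" using Cons.IH Cons.prems Cons by auto
      ultimately show ?thesis using Cons by auto
    qed simp
  qed simp
  then show ?thesis using assms by (auto simp: is_path_def)
qed

section \<open>The greedy algorithm\<close>

locale sym_hier_safe =
  fixes V :: "'a set" and E :: "'a set set" and S :: "'a \<Rightarrow> 'a \<Rightarrow> 'a set"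
  assumes graph: "is_graph (V, E)" and safe: "safe_sets V S"
    and symmetric: "symmetric_on V S" and hierarchical: "hierarchical_on V S"
begin

lemma finite_V: "finite V"
  using graph by (simp add: is_graph_def)

lemma edgeE:
  assumes "e \<in> E"
  obtains u v where "e = {u, v}" "u \<in> V" "v \<in> V" "u \<noteq> v"
  using assms graph unfolding is_graph_def by (metis card_2_iff insert_subset snd_conv fst_conv)

lemma safeD: "u \<in> V \<Longrightarrow> v \<in> V \<Longrightarrow> u \<in> S u v \<and> v \<in> S u v \<and> S u v \<subseteq> V"
  using safe by (auto simp: safe_sets_def)

lemma safe_sym: "u \<in> V \<Longrightarrow> v \<in> V \<Longrightarrow> S u v = S v u"
  using symmetric by (auto simp: symmetric_on_def)

lemma hierD: "x \<in> V \<Longrightarrow> y \<in> V \<Longrightarrow> z \<in> S x y \<Longrightarrow> S x z \<subseteq> S x y \<and> S z y \<subseteq> S x y"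
  using hierarchical safeD[of x y] unfolding hierarchical_on_def by blast

text \<open>From here on, paths are replaced by reachability in induced subgraphs, where symmetry
  and transitivity are at hand.\<close>

lemma feasible_iff:
  "feasible (V, E) S (V, F) \<longleftrightarrow> F \<subseteq> E \<and> (\<forall>x\<in>V. \<forall>y\<in>V. (x, y) \<in> (adj_in F (S x y))\<^sup>*)"
proof -
  have "(\<exists>xs. is_path (V, F) x xs y \<and> set xs \<subseteq> S x y) \<longleftrightarrow> (x, y) \<in> (adj_in F (S x y))\<^sup>*"
    if "x \<in> V" "y \<in> V" for x y
    using safeD[OF that] path_imp_rtrancl rtrancl_imp_path by metis
  moreover have "subgraph (V, F) (V, E) \<longleftrightarrow> F \<subseteq> E"
    using graph by (auto simp: subgraph_def is_graph_def)
  ultimately show ?thesis by (simp add: feasible_def)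
qed

lemma feasible_pair: "feasible (V, E) S H \<Longrightarrow> H = (V, snd H)"
  using feasible_spanning by (metis fst_conv prod.collapse)

text \<open>This dichotomy makes every edge relevant to a single safe set.\<close>

lemma safe_dichotomy:
  assumes "x \<in> V" "y \<in> V" "p \<in> S x y" "q \<in> S x y"
  shows "S p q \<subseteq> S x y \<or> (S x p \<subset> S x y \<and> S x q \<subset> S x y)"
proof -
  have V: "p \<in> V" "q \<in> V" using assms safeD by blast+
  have "S x p \<subseteq> S x y" "S x q \<subseteq> S x y" using hierD assms by blast+
  \<comment> \<open>If \<open>S x p\<close> is all of \<open>S x y\<close>, it contains
    \<open>q\<close>, so the hierarchy puts \<open>S q p\<close> inside it, and symmetry turns this
    into \<open>S p q\<close>.\<close>
  moreover have "S p q \<subseteq> S x y" if "S x p = S x y"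
    using hierD[of x p q] safe_sym[of p q] assms V that by auto
  moreover have "S p q \<subseteq> S x y" if "S x q = S x y"
    using hierD[of x q p] assms V that by auto
  ultimately show ?thesis by blast
qed

text \<open>Every feasible subgraph connects the pairs in \<open>smaller A\<close> within \<open>A\<close>, whatever its edges
  with safe set exactly \<open>A\<close> are.\<close>

definition smaller :: "'a set \<Rightarrow> 'a rel" where
  "smaller A = {(p, q). p \<in> A \<and> q \<in> A \<and> S p q \<subset> A}"

lemma sym_smaller: "A \<subseteq> V \<Longrightarrow> sym (smaller A)"
  unfolding smaller_def sym_def by (auto, (metis safe_sym subsetD psubset_eq)+)

text \<open>The orientation is existential; symmetry of \<open>S\<close> makes the safe set of an
  edge within \<open>V\<close> independent of it.\<close>

definition edges_of :: "'a set set \<Rightarrow> 'a set \<Rightarrow> 'a set set" where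
  "edges_of F A = {e \<in> F. \<exists>u v. e = {u, v} \<and> S u v = A}"

lemma finite_edges_of:
  assumes "F \<subseteq> E"
  shows "finite (edges_of F A)"
proof (rule finite_subset)
  show "edges_of F A \<subseteq> Pow V" using assms graph unfolding edges_of_def is_graph_def fst_conv snd_conv by blast
qed (simp add: finite_V)

text \<open>If \<open>S x p\<close> and \<open>S x q\<close> are both proper, \<open>p\<close> and
  \<open>q\<close> are joined through \<open>x\<close>. Otherwise \<open>S p q\<close> lies in
  \<open>S x y\<close>: it is either all of it, or (p, q) is itself a smaller pair.\<close>

lemma edge_dichotomy:
  assumes "x \<in> V" "y \<in> V" "p \<in> S x y" "q \<in> S x y"
  shows "S p q = S x y \<or> (p, q) \<in> (smaller (S x y))\<^sup>*"
proof -
  have V: "S x y \<subseteq> V" "x \<in> S x y" using assms safeD by blast+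
  show ?thesis
  proof (cases "S x p \<subset> S x y \<and> S x q \<subset> S x y")
    case True
    then have "(x, p) \<in> smaller (S x y)" "(x, q) \<in> smaller (S x y)"
      using assms V by (auto simp: smaller_def)
    then show ?thesis using sym_smaller[OF V(1)]
      by (meson symD converse_rtrancl_into_rtrancl r_into_rtrancl)
  next
    case False
    then show ?thesis using safe_dichotomy[OF assms] assms by (auto simp: smaller_def)
  qed
qed

lemma connected_in_safe:
  assumes "\<And>z. z \<in> S x y \<Longrightarrow> (x, z) \<in> (adj_in F (S x y))\<^sup>*" "p \<in> S x y" "q \<in> S x y"
  shows "(p, q) \<in> (adj_in F (S x y))\<^sup>*"
  using assms sym_rtrancl[OF sym_adj_in[of F "S x y"]] by (meson rtrancl_trans symD)

text \<open>Each vertex \<open>z\<close> of the safe set is joined to \<open>x\<close> inside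
  \<open>S x z\<close>, which the hierarchy keeps inside \<open>S x y\<close>.\<close>

lemma feasible_connected:
  assumes "feasible (V, E) S (V, F)" "x \<in> V" "y \<in> V" "p \<in> S x y" "q \<in> S x y"
  shows "(p, q) \<in> (adj_in F (S x y))\<^sup>*"
proof (rule connected_in_safe[OF _ assms(4,5)])
  fix z assume z: "z \<in> S x y"
  then have "z \<in> V" using assms safeD by blast
  with assms have "(x, z) \<in> (adj_in F (S x z))\<^sup>*" by (simp add: feasible_iff)
  moreover have "S x z \<subseteq> S x y" using hierD assms z by blast
  ultimately show "(x, z) \<in> (adj_in F (S x y))\<^sup>*" using adj_in_mono by blast
qed

section \<open>A condition on the edges of the graph that suffices for feasibility\<close>

definition settled :: "nat \<Rightarrow> 'a set set \<Rightarrow> bool" where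
  "settled k F \<longleftrightarrow> (\<forall>u v. {u, v} \<in> E \<longrightarrow> card (S u v) \<le> k \<longrightarrow> (u, v) \<in> (adj_in F (S u v))\<^sup>*)"

text \<open>The feasible \<open>F'\<close> serves as a scaffold: it connects the safe set, and each
  of its edges \<open>a\<close>, \<open>b\<close> there is replaced by a walk in \<open>F\<close>.
  If \<open>S a b\<close> lies in \<open>S x y\<close>, it is small enough for
  \<open>settled\<close> to give the walk. Otherwise \<open>S x a\<close> and \<open>S x b\<close>
  are proper subsets, and the induction on the size joins \<open>a\<close> and \<open>b\<close>
  through \<open>x\<close>.\<close>

lemma settled_connected:
  assumes feas: "feasible (V, E) S (V, F')" and "settled k F"
    and "x \<in> V" "y \<in> V" "card (S x y) \<le> k" "p \<in> S x y" "q \<in> S x y"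
  shows "(p, q) \<in> (adj_in F (S x y))\<^sup>*"
  using assms(3-)
proof (induction "card (S x y)" arbitrary: x y p q rule: less_induct)
  case less
  note xy = \<open>x \<in> V\<close> \<open>y \<in> V\<close>
  have SV: "S x y \<subseteq> V" using safeD xy by blast
  have fin: "finite (S x y)" using SV finite_V finite_subset by blast
  have edge: "(a, b) \<in> (adj_in F (S x y))\<^sup>*" if ab: "(a, b) \<in> adj_in F' (S x y)" for a b
  proof -
    have mem: "a \<in> S x y" "b \<in> S x y" "{a, b} \<in> E"
      using ab feas by (auto simp: adj_in_def feasible_iff)
    from safe_dichotomy[OF xy mem(1,2)] show ?thesis
    proof
      assume sub: "S a b \<subseteq> S x y"
      then have "card (S a b) \<le> k" using card_mono[OF fin sub] less.prems(3) by simp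
      then have "(a, b) \<in> (adj_in F (S a b))\<^sup>*" using \<open>settled k F\<close> mem by (simp add: settled_def)
      then show ?thesis using adj_in_mono[OF subset_refl sub] by blast
    next
      assume A: "S x a \<subset> S x y \<and> S x b \<subset> S x y"
      have "(x, c) \<in> (adj_in F (S x y))\<^sup>*" if c: "c \<in> S x y" "S x c \<subset> S x y" for c
      proof -
        have "card (S x c) < card (S x y)" by (rule psubset_card_mono[OF fin c(2)])
        moreover have "c \<in> V" using c SV by blast
        ultimately have "(x, c) \<in> (adj_in F (S x c))\<^sup>*"
          using less xy safeD[of x c] by (intro less.hyps) auto
        then show ?thesis using adj_in_mono c(2) by blast
      qed
      with A mem show ?thesis
        using sym_rtrancl[OF sym_adj_in[of F "S x y"]] by (meson rtrancl_trans symD)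
    qed
  qed
  have "(p, q) \<in> (adj_in F' (S x y))\<^sup>*"
    using feasible_connected[OF feas] less.prems by blast
  moreover have "(adj_in F' (S x y))\<^sup>* \<subseteq> (adj_in F (S x y))\<^sup>*"
    using edge by (intro rtrancl_subset_rtrancl) auto
  ultimately show ?case by blast
qed

lemma settled_feasible:
  assumes "feasible (V, E) S H" "F \<subseteq> E" "settled (card V) F"
  shows "feasible (V, E) S (V, F)"
proof -
  have "(x, y) \<in> (adj_in F (S x y))\<^sup>*" if "x \<in> V" "y \<in> V" for x y
    using settled_connected[of "snd H" "card V" F x y x y] assms feasible_pair[OF assms(1)] safeD[OF that] that
      card_mono[OF finite_V, of "S x y"] by simp
  with assms(2) show ?thesis by (simp add: feasible_iff)
qed

section \<open>Counting edges by safe set and the lower bound\<close>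

lemma safe_edge_unique:
  assumes "u \<in> V" "v \<in> V" "{u, v} = {u', v'}"
  shows "S u v = S u' v'"
  using assms safe_sym by (auto simp: doubleton_eq_iff)

lemma edges_of_insert:
  assumes "u \<in> V" "v \<in> V"
  shows "edges_of (insert {u, v} F) A = (if S u v = A then insert {u, v} (edges_of F A) else edges_of F A)"
proof -
  have "{e \<in> insert {u, v} F. Q e} = (if Q {u, v} then insert {u, v} {e \<in> F. Q e} else {e \<in> F. Q e})" for Q
    by auto
  moreover have "(\<exists>a b. {u, v} = {a, b} \<and> S a b = A) \<longleftrightarrow> S u v = A"
    using safe_edge_unique[OF assms] by blast
  ultimately show ?thesis unfolding edges_of_def by simp
qed

text \<open>Each edge has exactly one safe set. The sum ranges over the sets, not the pairs, so a
  safe set shared by several pairs counts once.\<close>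

lemma card_eq_sum_edges_of:
  assumes "F \<subseteq> E"
  shows "card F = (\<Sum>A\<in>case_prod S ` (V \<times> V). card (edges_of F A))"
proof -
  let ?I = "case_prod S ` (V \<times> V)"
  have "F = (\<Union>A\<in>?I. edges_of F A)"
  proof (intro equalityI subsetI)
    fix e assume "e \<in> F"
    with assms obtain u v where "e = {u, v}" "u \<in> V" "v \<in> V" by (meson edgeE subsetD)
    with \<open>e \<in> F\<close> show "e \<in> (\<Union>A\<in>?I. edges_of F A)" by (force simp: edges_of_def)
  qed (auto simp: edges_of_def)
  moreover have "card (\<Union>A\<in>?I. edges_of F A) = (\<Sum>A\<in>?I. card (edges_of F A))"
  proof (rule card_UN_disjoint)
    show "finite ?I" using finite_V by simp
    show "\<forall>A\<in>?I. finite (edges_of F A)"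
      using finite_edges_of[OF assms] by simp
    have "edges_of F A \<inter> edges_of F B = {}" if "A \<noteq> B" for A B
    proof (rule ccontr)
      assume "edges_of F A \<inter> edges_of F B \<noteq> {}"
      then obtain u v u' v' where "{u, v} \<in> F" "S u v = A" "S u' v' = B" "{u, v} = {u', v'}"
        unfolding edges_of_def by blast
      moreover from this have "{u, v} \<subseteq> V"
        using assms graph unfolding is_graph_def by (metis fst_conv snd_conv subsetD)
      ultimately show False using safe_edge_unique[of u v u' v'] that by blast
    qed
    then show "\<forall>A\<in>?I. \<forall>B\<in>?I. A \<noteq> B \<longrightarrow> edges_of F A \<inter> edges_of F B = {}" by simp
  qed
  ultimately show ?thesis by metis
qed

text \<open>After contracting \<open>smaller A\<close>, the edges of \<open>F\<close> with safe set
  \<open>A\<close> form a forest. For \<open>F\<close> within \<open>E\<close> the converse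
  inequality is \<open>num_components_adj_le\<close>, so equality holds: no edge is wasted.\<close>

definition forest_like :: "'a set set \<Rightarrow> bool" where
  "forest_like F \<longleftrightarrow> (\<forall>A\<in>case_prod S ` (V \<times> V).
     num_components V (smaller A \<union> adj (edges_of F A)) + card (edges_of F A)
       \<le> num_components V (smaller A))"

text \<open>For each safe set \<open>A\<close>, the smaller pairs and the edges of \<open>F'\<close>
  for \<open>A\<close> together connect all of \<open>A\<close>, so no relation within
  \<open>A\<close> leaves fewer components. \<open>F'\<close> paid at least one edge per component
  lost, \<open>F\<close> at most one.\<close>

lemma forest_like_le_feasible:
  assumes F: "F \<subseteq> E" "forest_like F" and feas: "feasible (V, E) S (V, F')"
  shows "card F \<le> card F'"
proof -
  have F': "F' \<subseteq> E" using feas by (simp add: feasible_iff)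
  have "card (edges_of F A) \<le> card (edges_of F' A)" if A: "A \<in> case_prod S ` (V \<times> V)" for A
  proof -
    obtain x y where xy: "x \<in> V" "y \<in> V" "A = S x y" using A by auto
    have AV: "A \<subseteq> V" using safeD xy by blast
    have sub: "edges_of F A \<subseteq> E" "edges_of F' A \<subseteq> E"
      using F F' by (auto simp: edges_of_def)
    have "adj_in F' A \<subseteq> (smaller A \<union> adj (edges_of F' A))\<^sup>*"
    proof (rule subrelI)
      fix p q assume pq: "(p, q) \<in> adj_in F' A"
      then have "S p q = A \<or> (p, q) \<in> (smaller A)\<^sup>*"
        using edge_dichotomy[of x y p q] xy by (auto simp: adj_in_def)
      then show "(p, q) \<in> (smaller A \<union> adj (edges_of F' A))\<^sup>*"
      proof
        assume "S p q = A"
        then have "(p, q) \<in> adj (edges_of F' A)"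
          using pq by (auto simp: adj_in_def adj_def edges_of_def)
        then show ?thesis by blast
      qed (meson in_rtrancl_UnI)
    qed
    then have conn: "(adj_in F' A)\<^sup>* \<subseteq> (smaller A \<union> adj (edges_of F' A))\<^sup>*"
      by (rule rtrancl_subset_rtrancl)
    \<comment> \<open>Both ends of an edge with safe set \<open>A\<close> lie in \<open>A\<close>,
      so \<open>F\<close> cannot merge anything that \<open>F'\<close> leaves separate.\<close>
    have "smaller A \<union> adj (edges_of F A) \<subseteq> A \<times> A"
    proof -
      have "{p, q} \<subseteq> A" if "{p, q} \<in> edges_of F A" for p q
      proof -
        from that obtain u v where uv: "{p, q} = {u, v}" "S u v = A" "{p, q} \<in> E"
          using F unfolding edges_of_def by blast
        then have "u \<in> V" "v \<in> V" using graph by (auto simp: is_graph_def)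
        then show ?thesis using safeD uv by auto
      qed
      then show ?thesis by (auto simp: smaller_def adj_def)
    qed
    also have "A \<times> A \<subseteq> (adj_in F' A)\<^sup>*"
      using feasible_connected[OF feas] xy by auto
    finally have le: "num_components V (smaller A \<union> adj (edges_of F' A))
        \<le> num_components V (smaller A \<union> adj (edges_of F A))"
      using conn by (intro num_components_antimono finite_V sym_Un sym_smaller[OF AV] sym_adj) auto
    have "\<forall>e\<in>edges_of F' A. e \<subseteq> V \<and> card e = 2" using sub graph by (auto simp: is_graph_def)
    moreover have "finite (edges_of F' A)" using finite_edges_of[OF F'] .
    ultimately have "num_components V (smaller A)
        \<le> num_components V (smaller A \<union> adj (edges_of F' A)) + card (edges_of F' A)"
      by (intro num_components_adj_le finite_V sym_smaller AV)
    with le bspec[OF F(2)[unfolded forest_like_def] A] show ?thesis by linarith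
  qed
  then show ?thesis
    unfolding card_eq_sum_edges_of[OF F(1)] card_eq_sum_edges_of[OF F'] by (rule sum_mono)
qed

text \<open>Only the class of \<open>A = S u v\<close> changes. Smaller pairs of \<open>A\<close>
  have safe sets of size at most \<open>k\<close>, so \<open>F\<close> already joins them inside
  \<open>A\<close>; since it does not join \<open>u\<close> and \<open>v\<close> there, the new edge
  lowers the component count by one.\<close>

lemma forest_like_insert:
  assumes feas: "feasible (V, E) S (V, F')" and F: "F \<subseteq> E" "forest_like F" "settled k F"
    and uv: "{u, v} \<in> E" "card (S u v) = Suc k" "(u, v) \<notin> (adj_in F (S u v))\<^sup>*"
  shows "forest_like (insert {u, v} F)"
  unfolding forest_like_def
proof
  fix A assume A: "A \<in> case_prod S ` (V \<times> V)"
  have V: "u \<in> V" "v \<in> V" using uv(1) graph by (auto simp: is_graph_def)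
  show "num_components V (smaller A \<union> adj (edges_of (insert {u, v} F) A))
      + card (edges_of (insert {u, v} F) A) \<le> num_components V (smaller A)"
  proof (cases "S u v = A")
    case False
    then show ?thesis
      using bspec[OF F(2)[unfolded forest_like_def] A] by (simp only: edges_of_insert[OF V] if_False)
  next
    case True
    have AV: "A \<subseteq> V" using True safeD V by blast
    have fin: "finite A" using AV finite_V finite_subset by blast
    have "smaller A \<subseteq> (adj_in F A)\<^sup>*"
    proof (rule subrelI)
      fix p q assume "(p, q) \<in> smaller A"
      then have pq: "p \<in> V" "q \<in> V" "S p q \<subset> A" using AV by (auto simp: smaller_def)
      then have "card (S p q) \<le> k" using psubset_card_mono[OF fin, of "S p q"] uv(2) True by simp
      then have "(p, q) \<in> (adj_in F (S p q))\<^sup>*"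
        using settled_connected[OF feas F(3) pq(1,2)] safeD[OF pq(1,2)] by blast
      then show "(p, q) \<in> (adj_in F A)\<^sup>*" using adj_in_mono pq(3) by blast
    qed
    moreover have "adj (edges_of F A) \<subseteq> adj_in F A"
    proof (rule subrelI)
      fix p q assume "(p, q) \<in> adj (edges_of F A)"
      then obtain a b where ab: "{p, q} = {a, b}" "S a b = A" "{p, q} \<in> F"
        by (auto simp: adj_def edges_of_def)
      have "{a, b} \<subseteq> V"
        using F(1) graph ab unfolding is_graph_def by (metis fst_conv snd_conv subsetD)
      then have "a \<in> V" "b \<in> V" by simp_all
      with ab safeD[of a b] show "(p, q) \<in> adj_in F A" by (auto simp: adj_in_def doubleton_eq_iff)
    qed
    ultimately have "smaller A \<union> adj (edges_of F A) \<subseteq> (adj_in F A)\<^sup>*" by auto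
    then have "(smaller A \<union> adj (edges_of F A))\<^sup>* \<subseteq> (adj_in F A)\<^sup>*"
      by (rule rtrancl_subset_rtrancl)
    then have "(u, v) \<notin> (smaller A \<union> adj (edges_of F A))\<^sup>*" using uv(3) True by blast
    from num_components_insert_new[OF finite_V sym_Un[OF sym_smaller[OF AV] sym_adj] V this]
    have step: "num_components V (smaller A \<union> adj (edges_of F A)) =
        Suc (num_components V (smaller A \<union> adj (insert {u, v} (edges_of F A))))"
      by (simp add: adj_insert)
    have "{u, v} \<notin> F"
      using uv(3) V safeD by (auto simp: adj_in_def)
    then have "{u, v} \<notin> edges_of F A" by (simp add: edges_of_def)
    moreover have "finite (edges_of F A)" using finite_edges_of[OF F(1)] .
    ultimately show ?thesis using step bspec[OF F(2)[unfolded forest_like_def] A]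
      by (simp add: edges_of_insert[OF V] True)
  qed
qed

section \<open>The greedy choice and its invariant\<close>

definition greedy_step :: "nat \<Rightarrow> 'a \<times> 'a \<Rightarrow> 'a set set \<Rightarrow> 'a set set" where
  "greedy_step k = (\<lambda>(u, v) F.
     if {u, v} \<in> E \<and> card (S u v) = Suc k \<and> (u, v) \<notin> (adj_in F (S u v))\<^sup>*
     then insert {u, v} F else F)"

text \<open>Round \<open>k\<close> treats safe sets of size \<open>Suc k\<close>, so it starts from
  edges settled up to \<open>k\<close>.\<close>

definition greedy_inv :: "nat \<Rightarrow> 'a set set \<Rightarrow> bool" where
  "greedy_inv k F \<longleftrightarrow> F \<subseteq> E \<and> settled k F \<and> forest_like F"

lemma greedy_step_settles:
  assumes "{u, v} \<in> E" "card (S u v) = Suc k"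
  shows "(u, v) \<in> (adj_in (greedy_step k (u, v) F) (S u v))\<^sup>*"
proof (cases "(u, v) \<in> (adj_in F (S u v))\<^sup>*")
  case False
  have "u \<in> S u v" "v \<in> S u v" using safeD assms(1) graph by (auto simp: is_graph_def)
  then show ?thesis using False assms by (auto simp: greedy_step_def adj_in_def)
qed (use assms in \<open>simp add: greedy_step_def\<close>)

lemma greedy_step_mono: "F \<subseteq> greedy_step k uv F"
  by (auto simp: greedy_step_def split: prod.split)

text \<open>The index stays at \<open>k\<close> during a round; the second conjunct, once taken over
  all pairs, allows passing to \<open>Suc k\<close>.\<close>

lemma fold_greedy_step:
  assumes feas: "feasible (V, E) S (V, F')" and "greedy_inv k F"
  shows "greedy_inv k (fold (greedy_step k) uvs F) \<and>
    (\<forall>(u, v)\<in>set uvs. {u, v} \<in> E \<longrightarrow> card (S u v) = Suc k \<longrightarrow>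
       (u, v) \<in> (adj_in (fold (greedy_step k) uvs F) (S u v))\<^sup>*)"
proof (induction uvs rule: rev_induct)
  case Nil
  show ?case using assms by simp
next
  case (snoc uv uvs)
  obtain u v where uv: "uv = (u, v)" by fastforce
  let ?F = "fold (greedy_step k) uvs F"
  have mono: "adj_in ?F A \<subseteq> adj_in (greedy_step k uv ?F) A" for A
    using greedy_step_mono[of ?F k uv] by (auto simp: adj_in_def)
  then have mono': "(adj_in ?F A)\<^sup>* \<subseteq> (adj_in (greedy_step k uv ?F) A)\<^sup>*" for A
    by (rule rtrancl_mono)
  have inv: "?F \<subseteq> E" "settled k ?F" "forest_like ?F" using snoc by (auto simp: greedy_inv_def)
  have "settled k (greedy_step k uv ?F)"
    using inv(2) mono' unfolding settled_def by blast
  moreover have "greedy_step k uv ?F \<subseteq> E" using inv(1) by (auto simp: greedy_step_def uv)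
  moreover have "forest_like (greedy_step k uv ?F)"
    using forest_like_insert[OF feas inv(1,3,2)] inv(3) by (auto simp: greedy_step_def uv)
  ultimately have "greedy_inv k (greedy_step k uv ?F)" by (simp add: greedy_inv_def)
  then show ?case using snoc mono' greedy_step_settles[of u v k ?F] uv by auto blast
qed

text \<open>Every edge is met in both orientations; the second visit finds its ends connected and
  adds nothing.\<close>

definition greedy :: "'a list \<Rightarrow> 'a set set" where
  "greedy vs = fold (\<lambda>k. fold (\<lambda>u. fold (\<lambda>v. greedy_step k (u, v)) vs) vs) [0..<length vs] {}"

lemma fold_nested: "fold (\<lambda>u. fold (\<lambda>v. f (u, v)) vs) us = fold f (List.product us vs)"
  by (induction us) (auto simp: fold_map comp_def fun_eq_iff)

lemma greedy_inv_greedy: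
  assumes feas: "feasible (V, E) S (V, F')" and vs: "set vs = V"
  shows "greedy_inv (length vs) (greedy vs)"
proof -
  have "greedy_inv m (fold (\<lambda>k. fold (greedy_step k) (List.product vs vs)) [0..<m] {})" for m
  proof (induction m)
    case 0
    \<comment> \<open>The safe set of an edge contains its ends, so none has size 0.\<close>
    have "settled 0 {}"
    proof -
      have "card (S u v) \<noteq> 0" if "{u, v} \<in> E" for u v
      proof -
        have V: "u \<in> V" "v \<in> V" using that graph by (auto simp: is_graph_def)
        show ?thesis using safeD[OF V] finite_subset[OF _ finite_V, of "S u v"] by auto
      qed
      then show ?thesis unfolding settled_def le_zero_eq by metis
    qed
    then show ?case by (simp add: greedy_inv_def forest_like_def edges_of_def adj_def)
  next
    case (Suc m)
    let ?F = "fold (greedy_step m) (List.product vs vs)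
       (fold (\<lambda>k. fold (greedy_step k) (List.product vs vs)) [0..<m] {})"
    from fold_greedy_step[OF feas Suc, of "List.product vs vs"]
    have F: "greedy_inv m ?F"
      "\<And>u v. u \<in> V \<Longrightarrow> v \<in> V \<Longrightarrow> {u, v} \<in> E \<Longrightarrow> card (S u v) = Suc m \<Longrightarrow>
       (u, v) \<in> (adj_in ?F (S u v))\<^sup>*" using vs by auto
    have "settled (Suc m) ?F"
      using F graph unfolding greedy_inv_def settled_def le_Suc_eq is_graph_def by auto
    then show ?case using F(1) by (simp add: greedy_inv_def)
  qed
  then show ?thesis by (simp add: greedy_def fold_nested)
qed

text \<open>Kept apart from \<open>greedy_inv_greedy\<close>, which presupposes a feasible subgraph:
  the final check has to be interpreted on infeasible instances too.\<close>

lemma greedy_subset: "greedy vs \<subseteq> E"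
proof -
  have "greedy_step k uv F \<subseteq> E" if "F \<subseteq> E" for k uv F
    using that by (auto simp: greedy_step_def split: prod.split)
  then have step: "fold (greedy_step k) uvs F \<subseteq> E" if "F \<subseteq> E" for k uvs F
    using that by (induction uvs arbitrary: F) simp_all
  have "fold (\<lambda>k. fold (greedy_step k) (List.product vs vs)) ks F \<subseteq> E" if "F \<subseteq> E" for ks F
    using that by (induction ks arbitrary: F) (simp_all add: step)
  then show ?thesis by (simp add: greedy_def fold_nested)
qed

lemma greedy_optimal:
  assumes "feasible (V, E) S H" "set vs = V"
  shows "optimal (V, E) S (V, greedy vs)"
proof -
  have pair: "H' = (V, snd H')" if "feasible (V, E) S H'" for H'
    using feasible_pair[OF that] .
  have inv: "greedy_inv (length vs) (greedy vs)"
    using greedy_inv_greedy assms pair by metis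
  have "card V \<le> length vs" using assms(2) card_length by blast
  then have "settled (card V) (greedy vs)"
    using inv by (auto simp: greedy_inv_def settled_def)
  then have "feasible (V, E) S (V, greedy vs)"
    using settled_feasible[OF assms(1) greedy_subset] by blast
  moreover have "card (greedy vs) \<le> card (snd H')" if "feasible (V, E) S H'" for H'
    using forest_like_le_feasible[of "greedy vs" "snd H'"] inv that pair[OF that]
    by (simp add: greedy_inv_def)
  ultimately show ?thesis unfolding optimal_def is_arg_min_def by fastforce
qed

end

section \<open>Implementation on the machine\<close>

lemma nth_concat_uniform:
  assumes "\<And>i. i < m \<Longrightarrow> length (f i) = k"
  shows "length (concat (map f [0..<m])) = m * k"
    and "i < m \<Longrightarrow> j < k \<Longrightarrow> concat (map f [0..<m]) ! (i * k + j) = f i ! j"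
proof -
  have "length (concat (map f [0..<m])) = m * k \<and>
    (\<forall>i<m. \<forall>j<k. concat (map f [0..<m]) ! (i * k + j) = f i ! j)"
    using assms
  proof (induction m)
    case (Suc m)
    have "i * k + j < m * k" if "i < m" "j < k" for i j
    proof -
      have "i * k + j < Suc i * k" using that by simp
      also have "\<dots> \<le> m * k" using that by (intro mult_le_mono) auto
      finally show ?thesis .
    qed
    with Suc show ?case by (auto simp: nth_append less_Suc_eq)
  qed simp
  then show "length (concat (map f [0..<m])) = m * k"
    and "i < m \<Longrightarrow> j < k \<Longrightarrow> concat (map f [0..<m]) ! (i * k + j) = f i ! j"
    by blast+
qed

section \<open>Row-major addresses\<close>

definition idx2 :: "nat \<Rightarrow> nat \<Rightarrow> nat \<Rightarrow> nat" where
  "idx2 n u v = u * n + v"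

definition idx3 :: "nat \<Rightarrow> nat \<Rightarrow> nat \<Rightarrow> nat \<Rightarrow> nat" where
  "idx3 n x y w = x * (n * n) + idx2 n y w"

lemma digit_bound: "u < m \<Longrightarrow> v < k \<Longrightarrow> u * k + v < m * (k :: nat)"
proof -
  assume a: "u < m" "v < k"
  have "u * k + v < Suc u * k" using a by simp
  also have "\<dots> \<le> m * k" using a by (intro mult_le_mono) auto
  finally show ?thesis .
qed

lemma digit_inject:
  "v < k \<Longrightarrow> v' < k \<Longrightarrow> u * k + v = u' * k + v' \<longleftrightarrow> u = u' \<and> v = (v' :: nat)"
  by (metis add.commute add_left_cancel div_mult_self3 div_less add_0_right mult.commute less_nat_zero_code)

lemma idx2_bound: "u < n \<Longrightarrow> v < n \<Longrightarrow> idx2 n u v < n * n"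
  unfolding idx2_def by (rule digit_bound)

lemma idx3_bound: "x < n \<Longrightarrow> y < n \<Longrightarrow> w < n \<Longrightarrow> idx3 n x y w < n * (n * n)"
  unfolding idx3_def by (intro digit_bound idx2_bound)

lemma idx2_inject: "v < n \<Longrightarrow> v' < n \<Longrightarrow> idx2 n u v = idx2 n u' v' \<longleftrightarrow> u = u' \<and> v = v'"
  unfolding idx2_def by (rule digit_inject)

lemma idx3_inject:
  "y < n \<Longrightarrow> w < n \<Longrightarrow> y' < n \<Longrightarrow> w' < n \<Longrightarrow>
   idx3 n x y w = idx3 n x' y' w' \<longleftrightarrow> x = x' \<and> y = y' \<and> w = w'"
  unfolding idx3_def using digit_inject[OF idx2_bound idx2_bound] idx2_inject by metis

lemma length_adj_bits: "length (adj_bits n E) = n * n"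
  unfolding adj_bits_def by (subst nth_concat_uniform(1)[where k = n]) auto

lemma nth_adj_bits: "u < n \<Longrightarrow> v < n \<Longrightarrow> adj_bits n E ! idx2 n u v = ({u, v} \<in> E)"
  unfolding adj_bits_def idx2_def by (subst nth_concat_uniform(2)[where k = n]) auto

lemma length_safe_bits: "length (safe_bits n S) = n * (n * n)"
  unfolding safe_bits_def
  by (subst nth_concat_uniform(1)[where k = "n * n"]) (auto simp: nth_concat_uniform(1)[where k = n])

lemma nth_safe_bits:
  "x < n \<Longrightarrow> y < n \<Longrightarrow> w < n \<Longrightarrow> safe_bits n S ! idx3 n x y w = (w \<in> S x y)"
proof -
  assume a: "x < n" "y < n" "w < n"
  have "concat (map (\<lambda>v. map (\<lambda>w. w \<in> S x v) [0..<n]) [0..<n]) ! idx2 n y w = (w \<in> S x y)"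
    unfolding idx2_def using a by (subst nth_concat_uniform(2)[where k = n]) auto
  then show ?thesis unfolding safe_bits_def idx3_def using a idx2_bound[OF a(2,3)]
    by (subst nth_concat_uniform(2)[where k = "n * n"]) (auto simp: nth_concat_uniform(1)[where k = n])
qed

text \<open>Registers 4 to 7 hold the base addresses of the arrays for the edges \<open>E\<close>, the safe sets
  \<open>S\<close>, the edges chosen so far, and the component labels \<open>L x y w\<close> of \<open>w\<close> in the chosen subgraph
  induced on \<open>S x y\<close>. The machine cannot multiply, so registers 8 and 9 point to tables of
  \<open>u * n\<close> and \<open>u * (n * n)\<close>. The output is written over the input only at the end.\<close>

definition at2 :: "nat \<Rightarrow> nat \<Rightarrow> nat \<Rightarrow> expr" where
  "at2 b u v = Add (Reg b) (Add (Mem (Add (Reg 8) (Reg u))) (Reg v))"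

definition at3 :: "nat \<Rightarrow> nat \<Rightarrow> nat \<Rightarrow> nat \<Rightarrow> expr" where
  "at3 b x y w = Add (Reg b) (Add (Mem (Add (Reg 9) (Reg x))) (Add (Mem (Add (Reg 8) (Reg y))) (Reg w)))"

text \<open>Subtraction is truncated, so a difference in one direction alone does not detect inequality.\<close>

definition neq :: "expr \<Rightarrow> expr \<Rightarrow> expr" where
  "neq a b = Add (Sub a b) (Sub b a)"

lemma expr_val_neq [simp]: "expr_val (neq a b) s = 0 \<longleftrightarrow> expr_val a s = expr_val b s"
  by (auto simp: neq_def)

text \<open>In the programs up to the check, register 10 holds the round, 11 and 12 the edge under
  consideration, 14 and 15 the pair naming a safe set, 13 a running vertex, 16 a size, 17 and 18 the
  old and new label, 19 the verdict.\<close>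

definition init_prog :: loop_prog where
  "init_prog = LFor 14 (LFor 15 (LFor 13 (LStore (at3 7 14 15 13) (Reg 13))))"

definition count_prog :: loop_prog where
  "count_prog = LSeq (LAssign 16 (Const 0))
     (LFor 13 (LAssign 16 (Add (Reg 16) (Mem (at3 5 11 12 13)))))"

text \<open>Both labels are saved beforehand, because the loop overwrites the label of
  \<open>u\<close> itself.\<close>

definition relabel_prog :: loop_prog where
  "relabel_prog = LSeq (LAssign 17 (Mem (at3 7 14 15 11))) (LSeq (LAssign 18 (Mem (at3 7 14 15 12)))
     (LFor 13 (LIf (neq (Mem (at3 7 14 15 13)) (Reg 17)) LSkip (LStore (at3 7 14 15 13) (Reg 18)))))"

text \<open>A new edge affects every safe set that contains both its ends, not only its own.\<close>

definition relabel_all_prog :: loop_prog where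
  "relabel_all_prog = LFor 14 (LFor 15
     (LIf (Mem (at3 5 14 15 11)) (LIf (Mem (at3 5 14 15 12)) relabel_prog LSkip) LSkip))"

definition step_prog :: loop_prog where
  "step_prog = LIf (Mem (at2 4 11 12))
     (LSeq count_prog (LIf (neq (Reg 16) (Add (Reg 10) (Const 1))) LSkip
       (LIf (neq (Mem (at3 7 11 12 11)) (Mem (at3 7 11 12 12)))
         (LSeq (LStore (at2 6 11 12) (Const 1)) (LSeq (LStore (at2 6 12 11) (Const 1)) relabel_all_prog))
         LSkip)))
     LSkip"

definition greedy_prog :: loop_prog where
  "greedy_prog = LFor 10 (LFor 11 (LFor 12 step_prog))"

definition check_prog :: loop_prog where
  "check_prog = LSeq (LAssign 19 (Const 1)) (LFor 14 (LFor 15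
     (LIf (neq (Mem (at3 7 14 15 14)) (Mem (at3 7 14 15 15))) (LAssign 19 (Const 0)) LSkip)))"

text \<open>The double loop serves to count to n*n, as a single loop only reaches n; register 20 is
  the linear index.\<close>

definition output_prog :: loop_prog where
  "output_prog = LIf (Reg 19)
     (LSeq (LAssign 20 (Const 0)) (LSeq
       (LFor 14 (LFor 15 (LSeq (LStore (Add (Reg 20) (Const 1)) (Mem (Add (Reg 6) (Reg 20))))
          (LAssign 20 (Add (Reg 20) (Const 1))))))
       (LSeq (LStore (Const 0) (Const 1)) (LAssign 0 (Add (Reg 20) (Const 1))))))
     (LSeq (LStore (Const 0) (Const 0)) (LAssign 0 (Const 1)))"

lemmas prog_defs = init_prog_def count_prog_def relabel_prog_def relabel_all_prog_def
  step_prog_def greedy_prog_def check_prog_def output_prog_def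

section \<open>Memory representation and correctness of the subprograms\<close>

locale cc_run = sym_hier_safe "{..<n}" E S for n :: nat and E S
begin

text \<open>The blocks follow each other without gaps from address n + 1, just behind the unary n
  and its separator; so \<open>E\<close> and \<open>S\<close> are read where the input has
  them.\<close>

definition regs_ok :: "(nat \<Rightarrow> nat) \<Rightarrow> bool" where
  "regs_ok R \<longleftrightarrow> R 1 = n \<and> R 4 = n + 1 \<and> R 5 = n + 1 + n * n \<and>
     R 6 = n + 1 + n * n + n * (n * n) \<and> R 7 = n + 1 + n * n + n * (n * n) + n * n \<and>
     R 8 = n + 1 + n * n + n * (n * n) + n * n + n * (n * n) \<and>
     R 9 = n + 1 + n * n + n * (n * n) + n * n + n * (n * n) + n"

text \<open>The parameters \<open>h\<close> and \<open>L\<close> are the two arrays that change: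
  chosen edges and labels.\<close>

definition rep :: "(nat \<Rightarrow> nat \<Rightarrow> nat) \<Rightarrow> (nat \<Rightarrow> nat \<Rightarrow> nat \<Rightarrow> nat) \<Rightarrow> state \<Rightarrow> bool" where
  "rep h L s \<longleftrightarrow> regs_ok (fst s) \<and>
     (\<forall>u<n. snd s (fst s 8 + u) = u * n \<and> snd s (fst s 9 + u) = u * (n * n)) \<and>
     (\<forall>u<n. \<forall>v<n. snd s (fst s 4 + idx2 n u v) = of_bool ({u, v} \<in> E)) \<and>
     (\<forall>x<n. \<forall>y<n. \<forall>w<n. snd s (fst s 5 + idx3 n x y w) = of_bool (w \<in> S x y)) \<and>
     (\<forall>u<n. \<forall>v<n. snd s (fst s 6 + idx2 n u v) = h u v) \<and>
     (\<forall>x<n. \<forall>y<n. \<forall>w<n. snd s (fst s 7 + idx3 n x y w) = L x y w)"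

lemma rep_reg: "rep h L s \<Longrightarrow> fst s 1 = n"
  by (auto simp: rep_def regs_ok_def)

lemma rep_set_reg: "r \<notin> {1, 4, 5, 6, 7, 8, 9} \<Longrightarrow> rep h L (set_reg r k s) = rep h L s"
  by (cases s) (simp add: rep_def regs_ok_def set_reg_def)

lemma rep_cong:
  assumes "rep h L s" "\<And>u v. u < n \<Longrightarrow> v < n \<Longrightarrow> h' u v = h u v"
    "\<And>x y w. x < n \<Longrightarrow> y < n \<Longrightarrow> w < n \<Longrightarrow> L' x y w = L x y w"
  shows "rep h' L' s"
  using assms by (cases s) (simp add: rep_def)

lemma at2_val: "rep h L s \<Longrightarrow> fst s u < n \<Longrightarrow> expr_val (at2 b u v) s = fst s b + idx2 n (fst s u) (fst s v)"
  by (cases s) (simp add: rep_def at2_def idx2_def)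

lemma at3_val:
  "rep h L s \<Longrightarrow> fst s x < n \<Longrightarrow> fst s y < n \<Longrightarrow>
   expr_val (at3 b x y w) s = fst s b + idx3 n (fst s x) (fst s y) (fst s w)"
  by (cases s) (simp add: rep_def at3_def idx2_def idx3_def)

lemma edge_val:
  "rep h L s \<Longrightarrow> fst s u < n \<Longrightarrow> fst s v < n \<Longrightarrow>
   snd s (expr_val (at2 4 u v) s) = of_bool ({fst s u, fst s v} \<in> E)"
  unfolding at2_val by (cases s) (simp add: rep_def)

lemma safe_val:
  "rep h L s \<Longrightarrow> fst s x < n \<Longrightarrow> fst s y < n \<Longrightarrow> fst s w < n \<Longrightarrow>
   snd s (expr_val (at3 5 x y w) s) = of_bool (fst s w \<in> S (fst s x) (fst s y))"
  unfolding at3_val by (cases s) (simp add: rep_def)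

lemma label_val:
  "rep h L s \<Longrightarrow> fst s x < n \<Longrightarrow> fst s y < n \<Longrightarrow> fst s w < n \<Longrightarrow>
   snd s (expr_val (at3 7 x y w) s) = L (fst s x) (fst s y) (fst s w)"
  unfolding at3_val by (cases s) (simp add: rep_def)

text \<open>No aliasing: the address stays inside its own block, and within the block
  \<open>idx2\<close> is injective.\<close>

lemma rep_store_h:
  assumes "rep h L s" "fst s u < n" "fst s v < n"
  shows "rep (\<lambda>a b. if a = fst s u \<and> b = fst s v then k else h a b) L (fst s, (snd s)(expr_val (at2 6 u v) s := k))"
proof -
  obtain R M where s: "s = (R, M)" by fastforce
  let ?a = "R 6 + idx2 n (R u) (R v)"
  have regs: "regs_ok R" using assms s by (simp add: rep_def)
  have b: "idx2 n (R u) (R v) < n * n" using assms s by (simp add: idx2_bound)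
  have "R 8 + x \<noteq> ?a" "R 9 + x \<noteq> ?a" for x using regs b by (auto simp: regs_ok_def)
  moreover have "R 4 + idx2 n x y \<noteq> ?a" if "x < n" "y < n" for x y
    using regs b idx2_bound[OF that] by (auto simp: regs_ok_def)
  moreover have "R 5 + idx3 n x y w \<noteq> ?a" if "x < n" "y < n" "w < n" for x y w
    using regs b idx3_bound[OF that] by (auto simp: regs_ok_def)
  moreover have "R 7 + idx3 n x y w \<noteq> ?a" if "x < n" "y < n" "w < n" for x y w
    using regs b by (auto simp: regs_ok_def)
  moreover have "R 6 + idx2 n x y = ?a \<longleftrightarrow> x = R u \<and> y = R v" if "x < n" "y < n" for x y
    using idx2_inject[of y n "R v" x "R u"] that assms s by auto
  ultimately show ?thesis using assms unfolding at2_val[OF assms(1,2)] by (auto simp: rep_def s)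
qed

lemma rep_store_l:
  assumes "rep h L s" "fst s x < n" "fst s y < n" "fst s w < n"
  shows "rep h (\<lambda>a b c. if a = fst s x \<and> b = fst s y \<and> c = fst s w then k else L a b c)
    (fst s, (snd s)(expr_val (at3 7 x y w) s := k))"
proof -
  obtain R M where s: "s = (R, M)" by fastforce
  let ?a = "R 7 + idx3 n (R x) (R y) (R w)"
  have regs: "regs_ok R" using assms s by (simp add: rep_def)
  have b: "idx3 n (R x) (R y) (R w) < n * (n * n)" using assms s by (simp add: idx3_bound)
  have "R 8 + x \<noteq> ?a" "R 9 + x \<noteq> ?a" for x using regs b by (auto simp: regs_ok_def)
  moreover have "R 4 + idx2 n x y \<noteq> ?a" if "x < n" "y < n" for x y
    using regs b idx2_bound[OF that] by (auto simp: regs_ok_def)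
  moreover have "R 5 + idx3 n x y w \<noteq> ?a" if "x < n" "y < n" "w < n" for x y w
    using regs b idx3_bound[OF that] by (auto simp: regs_ok_def)
  moreover have "R 6 + idx2 n x y \<noteq> ?a" if "x < n" "y < n" for x y
    using regs b idx2_bound[OF that] by (auto simp: regs_ok_def)
  moreover have "R 7 + idx3 n a b c = ?a \<longleftrightarrow> a = R x \<and> b = R y \<and> c = R w"
    if "a < n" "b < n" "c < n" for a b c
    using idx3_inject[of b n c "R y" "R w" a "R x"] that assms s by auto
  ultimately show ?thesis using assms unfolding at3_val[OF assms(1-3)] by (auto simp: rep_def s)
qed

lemma init_correct:
  assumes "rep h L s"
  shows "rep h (\<lambda>x y w. w) (sem init_prog s)"
proof -
  \<comment> \<open>The array in which exactly the cells lexicographically before (\<open>i\<close>,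
    \<open>j\<close>, \<open>k\<close>) are initialised.\<close>
  let ?L = "\<lambda>i j k x y w. if x < i \<or> x = i \<and> (y < j \<or> y = j \<and> w < k) then w else L x y (w :: nat)"
  have "rep h (?L n 0 0) (sem init_prog s)"
    unfolding init_prog_def
  proof (rule sem_LFor_induct[where P = "\<lambda>i. rep h (?L i 0 0)"])
    fix i s1
    assume i: "i < n" "fst s1 14 = i" and s1: "rep h (?L i 0 0) s1"
    have "rep h (?L i n 0) (sem (LFor 15 (LFor 13 (LStore (at3 7 14 15 13) (Reg 13)))) s1)"
    proof (rule sem_LFor_induct[where P = "\<lambda>j. rep h (?L i j 0)"])
      fix j s2
      assume j: "j < n" "fst s2 15 = j" and s2: "rep h (?L i j 0) s2"
        and r2: "\<And>r. r \<notin> mods (LFor 15 (LFor 13 (LStore (at3 7 14 15 13) (Reg 13)))) \<Longrightarrow> fst s2 r = fst s1 r"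
      have "rep h (?L i j n) (sem (LFor 13 (LStore (at3 7 14 15 13) (Reg 13))) s2)"
      proof (rule sem_LFor_induct[where P = "\<lambda>k. rep h (?L i j k)"])
        fix k s3
        assume k: "k < n" "fst s3 13 = k" and s3: "rep h (?L i j k) s3"
          and r3: "\<And>r. r \<notin> mods (LFor 13 (LStore (at3 7 14 15 13) (Reg 13))) \<Longrightarrow> fst s3 r = fst s2 r"
        have regs: "fst s3 14 = i" "fst s3 15 = j" using i j r2 r3 by auto
        have "rep h (\<lambda>a b c. if a = i \<and> b = j \<and> c = k then k else ?L i j k a b c)
            (sem (LStore (at3 7 14 15 13) (Reg 13)) s3)"
          using rep_store_l[OF s3, of 14 15 13 k] regs k i j by simp
        then show "rep h (?L i j (Suc k)) (set_reg 13 (Suc k) (sem (LStore (at3 7 14 15 13) (Reg 13)) s3))"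
          unfolding rep_set_reg[of 13, simplified] by (rule rep_cong) auto
      qed (use s2 rep_reg[OF s2] in \<open>simp_all add: rep_set_reg\<close>)
      then show "rep h (?L i (Suc j) 0)
         (set_reg 15 (Suc j) (sem (LFor 13 (LStore (at3 7 14 15 13) (Reg 13))) s2))"
        unfolding rep_set_reg[of 15, simplified] by (rule rep_cong) auto
    qed (use s1 rep_reg[OF s1] in \<open>simp_all add: rep_set_reg\<close>)
    then show "rep h (?L (Suc i) 0 0)
       (set_reg 14 (Suc i) (sem (LFor 15 (LFor 13 (LStore (at3 7 14 15 13) (Reg 13)))) s1))"
      unfolding rep_set_reg[of 14, simplified] by (rule rep_cong) auto
  qed (use assms rep_reg[OF assms] in \<open>simp_all add: rep_set_reg\<close>)
  then show ?thesis by (rule rep_cong) auto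
qed

lemma count_correct:
  assumes rep: "rep h L s" and uv: "fst s 11 < n" "fst s 12 < n"
  shows "rep h L (sem count_prog s) \<and> fst (sem count_prog s) 16 = card (S (fst s 11) (fst s 12))"
proof -
  let ?S = "S (fst s 11) (fst s 12)"
  have "?S \<subseteq> {..<n}" using safeD uv by simp
  then have all: "?S \<inter> {..<n} = ?S" by blast
  let ?c = "LAssign 16 (Add (Reg 16) (Mem (at3 5 11 12 13)))"
  have "rep h L (sem (LFor 13 ?c) (set_reg 16 0 s)) \<and>
     fst (sem (LFor 13 ?c) (set_reg 16 0 s)) 16 = card (?S \<inter> {..<n})"
  proof (rule sem_LFor_induct[where P = "\<lambda>k s'. rep h L s' \<and> fst s' 16 = card (?S \<inter> {..<k})"])
    fix k s'
    assume k: "k < n" "fst s' 13 = k"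
      and s': "rep h L s' \<and> fst s' 16 = card (?S \<inter> {..<k})"
      and r: "\<And>r. r \<notin> mods (LFor 13 ?c) \<Longrightarrow> fst s' r = fst (set_reg 16 0 s) r"
    have regs: "fst s' 11 = fst s 11" "fst s' 12 = fst s 12" using r by auto
    have "expr_val (Mem (at3 5 11 12 13)) s' = of_bool (k \<in> ?S)"
      using safe_val[of h L s' 11 12 13] s' k regs uv by simp
    moreover have "?S \<inter> {..<Suc k} = (if k \<in> ?S then insert k (?S \<inter> {..<k}) else ?S \<inter> {..<k})"
      by (auto simp: less_Suc_eq)
    ultimately show "rep h L (set_reg 13 (Suc k) (sem ?c s')) \<and>
      fst (set_reg 13 (Suc k) (sem ?c s')) 16 = card (?S \<inter> {..<Suc k})"
      using s' by (simp add: rep_set_reg)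
  qed (use rep rep_reg[OF rep] in \<open>simp_all add: rep_set_reg\<close>)
  then show ?thesis by (simp add: count_prog_def all)
qed

lemma relabel_correct:
  assumes rep: "rep h L s" and xy: "fst s 14 = x" "fst s 15 = y" "x < n" "y < n"
    and uv: "fst s 11 = u" "fst s 12 = v" "u < n" "v < n"
  shows "rep h (L(x := (L x)(y := relabel u v (L x y)))) (sem relabel_prog s)"
proof -
  let ?c = "LIf (neq (Mem (at3 7 14 15 13)) (Reg 17)) LSkip (LStore (at3 7 14 15 13) (Reg 18))"
  let ?L = "\<lambda>k a b c. if a = x \<and> b = y \<and> c < k then relabel u v (L x y) c else L a b c"
  define s1 where "s1 = sem (LAssign 17 (Mem (at3 7 14 15 11))) s"
  define s2 where "s2 = sem (LAssign 18 (Mem (at3 7 14 15 12))) s1"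
  have s1: "rep h L s1" "fst s1 17 = L x y u"
    using rep label_val[OF rep, of 14 15 11] xy uv by (simp_all add: s1_def rep_set_reg)
  have r1: "fst s1 14 = x" "fst s1 15 = y" "fst s1 12 = v" using xy uv by (simp_all add: s1_def)
  have s2: "rep h L s2" "fst s2 17 = L x y u" "fst s2 18 = L x y v"
    using s1 label_val[OF s1(1), of 14 15 12] r1 xy uv by (simp_all add: s2_def rep_set_reg)
  have r2: "fst s2 14 = x" "fst s2 15 = y" using r1 by (simp_all add: s2_def)
  have "rep h (?L n) (sem (LFor 13 ?c) s2)"
  proof (rule sem_LFor_induct[where P = "\<lambda>k. rep h (?L k)"])
    fix k s'
    assume k: "k < n" "fst s' 13 = k" and s': "rep h (?L k) s'"
      and r: "\<And>r. r \<notin> mods (LFor 13 ?c) \<Longrightarrow> fst s' r = fst s2 r"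
    have regs: "fst s' 14 = x" "fst s' 15 = y" "fst s' 17 = L x y u" "fst s' 18 = L x y v"
      using r r2 s2 by auto
    \<comment> \<open>Cell \<open>k\<close> has not been reached yet, so it still holds its original
      label.\<close>
    have val: "expr_val (Mem (at3 7 14 15 13)) s' = L x y k"
      using label_val[OF s', of 14 15 13] regs k xy by simp
    show "rep h (?L (Suc k)) (set_reg 13 (Suc k) (sem ?c s'))"
    proof (cases "L x y k = L x y u")
      case True
      have "rep h (\<lambda>a b c. if a = x \<and> b = y \<and> c = k then L x y v else ?L k a b c) (sem ?c s')"
        using rep_store_l[OF s', of 14 15 13 "L x y v"] regs k xy val True by simp
      then show ?thesis unfolding rep_set_reg[of 13, simplified]
        by (rule rep_cong) (auto simp: True relabel_def less_Suc_eq)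
    next
      case False
      then have "rep h (?L k) (sem ?c s')" using s' val regs by simp
      then show ?thesis unfolding rep_set_reg[of 13, simplified]
        by (rule rep_cong) (use False in \<open>auto simp: relabel_def less_Suc_eq\<close>)
    qed
  qed (use s2 rep_reg[OF s2(1)] in \<open>simp_all add: rep_set_reg\<close>)
  then have "rep h (?L n) (sem relabel_prog s)" by (simp add: relabel_prog_def s2_def s1_def)
  then show ?thesis by (rule rep_cong) auto
qed

lemma relabel_all_correct:
  assumes rep: "rep h L s" and uv: "fst s 11 = u" "fst s 12 = v" "u < n" "v < n"
  shows "rep h (\<lambda>x y. if u \<in> S x y \<and> v \<in> S x y then relabel u v (L x y) else L x y)
    (sem relabel_all_prog s)"
proof -
  let ?r = "\<lambda>x y. if u \<in> S x y \<and> v \<in> S x y then relabel u v (L x y) else L x y"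
  let ?L = "\<lambda>i j x y. if x < i \<or> x = i \<and> y < j then ?r x y else L x y"
  let ?c = "LIf (Mem (at3 5 14 15 11)) (LIf (Mem (at3 5 14 15 12)) relabel_prog LSkip) LSkip"
  have mods: "mods relabel_prog = {13, 17, 18}" "well_formed relabel_prog"
    by (auto simp: relabel_prog_def)
  have "rep h (?L n 0) (sem relabel_all_prog s)"
    unfolding relabel_all_prog_def
  proof (rule sem_LFor_induct[where P = "\<lambda>i. rep h (?L i 0)"])
    fix i s1
    assume i: "i < n" "fst s1 14 = i" and s1: "rep h (?L i 0) s1"
      and r1: "\<And>r. r \<notin> mods (LFor 14 (LFor 15 ?c)) \<Longrightarrow> fst s1 r = fst s r"
    have "rep h (?L i n) (sem (LFor 15 ?c) s1)"
    proof (rule sem_LFor_induct[where P = "\<lambda>j. rep h (?L i j)"])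
      fix j s2
      assume j: "j < n" "fst s2 15 = j" and s2: "rep h (?L i j) s2"
        and r2: "\<And>r. r \<notin> mods (LFor 15 ?c) \<Longrightarrow> fst s2 r = fst s1 r"
      have regs: "fst s2 14 = i" "fst s2 11 = u" "fst s2 12 = v"
        using i uv r1 r2 by (auto simp: mods)
      have val: "expr_val (Mem (at3 5 14 15 11)) s2 = of_bool (u \<in> S i j)"
        "expr_val (Mem (at3 5 14 15 12)) s2 = of_bool (v \<in> S i j)"
        using safe_val[OF s2, of 14 15] regs i j uv by simp_all
      show "rep h (?L i (Suc j)) (set_reg 15 (Suc j) (sem ?c s2))"
      proof (cases "u \<in> S i j \<and> v \<in> S i j")
        case True
        have "rep h ((?L i j)(i := (?L i j i)(j := relabel u v (L i j)))) (sem ?c s2)"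
          using relabel_correct[OF s2 regs(1) j(2) i(1) j(1) regs(2,3) uv(3,4)] val True by simp
        then show ?thesis unfolding rep_set_reg[of 15, simplified]
          by (rule rep_cong) (use True in \<open>auto simp: less_Suc_eq\<close>)
      next
        case False
        then have "rep h (?L i j) (sem ?c s2)" using s2 val by auto
        then show ?thesis unfolding rep_set_reg[of 15, simplified]
          by (rule rep_cong) (use False in \<open>auto simp: less_Suc_eq\<close>)
      qed
    qed (use s1 rep_reg[OF s1] in \<open>simp_all add: rep_set_reg mods\<close>)
    then show "rep h (?L (Suc i) 0) (set_reg 14 (Suc i) (sem (LFor 15 ?c) s1))"
      unfolding rep_set_reg[of 14, simplified] by (rule rep_cong) (auto simp: less_Suc_eq)
  qed (use rep rep_reg[OF rep] in \<open>simp_all add: rep_set_reg mods\<close>)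
  then show ?thesis by (rule rep_cong) auto
qed

section \<open>Simulation of the greedy algorithm\<close>

definition greedy_state :: "nat set set \<Rightarrow> state \<Rightarrow> bool" where
  "greedy_state F s \<longleftrightarrow> (\<exists>L. rep (\<lambda>u v. of_bool ({u, v} \<in> F)) L s \<and>
     (\<forall>x<n. \<forall>y<n. labelling {..<n} (adj_in F (S x y)) (L x y)))"

lemma greedy_state_set_reg:
  "r \<notin> {1, 4, 5, 6, 7, 8, 9} \<Longrightarrow> greedy_state F (set_reg r k s) = greedy_state F s"
  by (simp add: greedy_state_def rep_set_reg)

lemma greedy_state_reg: "greedy_state F s \<Longrightarrow> fst s 1 = n"
  unfolding greedy_state_def using rep_reg by blast

text \<open>Equality of the labels of \<open>u\<close> and \<open>v\<close> in the array of
  \<open>S u v\<close> is the connectivity test. The label values depend on the history and stay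
  existential in \<open>greedy_state\<close>; only the partition matters.\<close>

lemma step_correct:
  assumes state: "greedy_state F s" and uv: "fst s 10 = k" "fst s 11 = u" "fst s 12 = v" "u < n" "v < n"
  shows "greedy_state (greedy_step k (u, v) F) (sem step_prog s)"
proof -
  from state obtain L where rep: "rep (\<lambda>u v. of_bool ({u, v} \<in> F)) L s"
    and L: "\<And>x y. x < n \<Longrightarrow> y < n \<Longrightarrow> labelling {..<n} (adj_in F (S x y)) (L x y)"
    by (auto simp: greedy_state_def)
  define s1 where "s1 = sem count_prog s"
  have s1: "rep (\<lambda>u v. of_bool ({u, v} \<in> F)) L s1" "fst s1 16 = card (S u v)"
    using count_correct[OF rep] uv by (simp_all add: s1_def)
  have "fst s1 r = fst s r" if "r \<notin> {13, 16}" for r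
    unfolding s1_def by (rule sem_unmodified) (use that in \<open>simp add: count_prog_def\<close>)
  then have r1: "fst s1 10 = k" "fst s1 11 = u" "fst s1 12 = v" using uv by simp_all
  have edge: "snd s (expr_val (at2 4 11 12) s) = of_bool ({u, v} \<in> E)"
    using edge_val[OF rep, of 11 12] uv by simp
  have lab: "snd s1 (expr_val (at3 7 11 12 11) s1) = L u v u" "snd s1 (expr_val (at3 7 11 12 12) s1) = L u v v"
    using label_val[OF s1(1), of 11 12] r1 uv by simp_all
  have conn: "L u v u = L u v v \<longleftrightarrow> (u, v) \<in> (adj_in F (S u v))\<^sup>*"
    using L[OF uv(4,5)] uv by (simp add: labelling_def)
  show ?thesis
  proof (cases "{u, v} \<in> E \<and> card (S u v) = Suc k \<and> L u v u \<noteq> L u v v")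
    case False
    then have "sem step_prog s = s \<or> sem step_prog s = s1"
      using edge lab s1 r1 by (auto simp: step_prog_def s1_def)
    moreover have "greedy_state F s1" using s1 L by (auto simp: greedy_state_def)
    moreover have "greedy_step k (u, v) F = F" using False conn by (auto simp: greedy_step_def)
    ultimately show ?thesis using state by auto
  next
    case True
    define s2 where "s2 = sem (LStore (at2 6 11 12) (Const 1)) s1"
    define s3 where "s3 = sem (LStore (at2 6 12 11) (Const 1)) s2"
    let ?F = "insert {u, v} F"
    let ?L = "\<lambda>x y. if u \<in> S x y \<and> v \<in> S x y then relabel u v (L x y) else L x y"
    have "rep (\<lambda>a b. if a = u \<and> b = v then 1 else of_bool ({a, b} \<in> F)) L s2"
      using rep_store_h[OF s1(1), of 11 12 1] r1 uv by (simp add: s2_def)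
    from rep_store_h[OF this, of 12 11 1]
    have "rep (\<lambda>a b. if a = v \<and> b = u then 1 else if a = u \<and> b = v then 1 else of_bool ({a, b} \<in> F)) L s3"
      using r1 uv by (simp add: s3_def s2_def)
    moreover have "{a, b} \<in> ?F \<longleftrightarrow> a = v \<and> b = u \<or> a = u \<and> b = v \<or> {a, b} \<in> F" for a b
      by (auto simp only: doubleton_eq_iff insert_iff)
    moreover have "of_bool (P \<or> Q \<or> R) = (if P then 1 else if Q then 1 else of_bool R :: nat)" for P Q R
      by simp
    ultimately have s3: "rep (\<lambda>u v. of_bool ({u, v} \<in> ?F)) L s3" by (simp only:)
    have "rep (\<lambda>u v. of_bool ({u, v} \<in> ?F)) ?L (sem relabel_all_prog s3)"
      by (rule relabel_all_correct[OF s3]) (use r1 uv in \<open>simp_all add: s3_def s2_def\<close>)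
    moreover have "sem step_prog s = sem relabel_all_prog s3"
      using True edge lab s1 r1 by (simp add: step_prog_def s1_def[symmetric] s2_def s3_def)
    \<comment> \<open>A safe set that misses an end of the edge keeps its induced subgraph and its
      labels.\<close>
    moreover have "labelling {..<n} (adj_in ?F (S x y)) (?L x y)" if "x < n" "y < n" for x y
      using L[OF that] labelling_relabel[OF L[OF that] sym_adj_in, of u v] uv by (simp add: adj_in_insert)
    moreover have "greedy_step k (u, v) F = ?F" using True conn by (auto simp: greedy_step_def)
    ultimately show ?thesis unfolding greedy_state_def by auto
  qed
qed

lemma mods_step: "mods step_prog = {13, 14, 15, 16, 17, 18}" "well_formed step_prog"
  by (auto simp: step_prog_def count_prog_def relabel_all_prog_def relabel_prog_def)

lemma greedy_prog_correct:
  assumes "greedy_state {} s"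
  shows "greedy_state (greedy [0..<n]) (sem greedy_prog s)"
proof -
  have "greedy_state (fold (\<lambda>k. fold (\<lambda>u. fold (\<lambda>v. greedy_step k (u, v)) [0..<n]) [0..<n]) [0..<n] {})
     (sem (LFor 10 (LFor 11 (LFor 12 step_prog))) s)"
  proof (rule sem_LFor_fold)
    fix k F1 s1
    assume k: "k < n" "fst s1 10 = k" and s1: "greedy_state F1 s1"
    have "greedy_state (fold (\<lambda>u. fold (\<lambda>v. greedy_step k (u, v)) [0..<n]) [0..<n] F1)
       (sem (LFor 11 (LFor 12 step_prog)) s1)"
    proof (rule sem_LFor_fold)
      fix u F2 s2
      assume u: "u < n" "fst s2 11 = u" and s2: "greedy_state F2 s2"
        and r2: "\<And>r. r \<notin> mods (LFor 11 (LFor 12 step_prog)) \<Longrightarrow> fst s2 r = fst s1 r"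
      have "greedy_state (fold (\<lambda>v. greedy_step k (u, v)) [0..<n] F2) (sem (LFor 12 step_prog) s2)"
      proof (rule sem_LFor_fold)
        fix v F3 s3
        assume v: "v < n" "fst s3 12 = v" and s3: "greedy_state F3 s3"
          and r3: "\<And>r. r \<notin> mods (LFor 12 step_prog) \<Longrightarrow> fst s3 r = fst s2 r"
        have "fst s3 10 = k" "fst s3 11 = u" using k u r2 r3 by (auto simp: mods_step)
        from step_correct[OF s3 this v(2) u(1) v(1)]
        show "greedy_state (greedy_step k (u, v) F3) (set_reg 12 (Suc v) (sem step_prog s3))"
          by (simp add: greedy_state_set_reg)
      qed (use s2 greedy_state_reg[OF s2] in \<open>simp_all add: greedy_state_set_reg mods_step\<close>)
      then show "greedy_state (fold (\<lambda>v. greedy_step k (u, v)) [0..<n] F2)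
          (set_reg 11 (Suc u) (sem (LFor 12 step_prog) s2))"
        by (simp add: greedy_state_set_reg)
    qed (use s1 greedy_state_reg[OF s1] in \<open>simp_all add: greedy_state_set_reg mods_step\<close>)
    then show "greedy_state (fold (\<lambda>u. fold (\<lambda>v. greedy_step k (u, v)) [0..<n]) [0..<n] F1)
       (set_reg 10 (Suc k) (sem (LFor 11 (LFor 12 step_prog)) s1))"
      by (simp add: greedy_state_set_reg)
  qed (use assms greedy_state_reg[OF assms] in \<open>simp_all add: greedy_state_set_reg mods_step\<close>)
  then show ?thesis by (simp add: greedy_prog_def greedy_def)
qed

lemma check_correct:
  assumes "greedy_state F s"
  shows "greedy_state F (sem check_prog s) \<and> (fst (sem check_prog s) 19 \<noteq> 0 \<longleftrightarrow>
    (\<forall>x<n. \<forall>y<n. (x, y) \<in> (adj_in F (S x y))\<^sup>*))"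
proof -
  from assms obtain L where rep: "rep (\<lambda>u v. of_bool ({u, v} \<in> F)) L s"
    and L: "\<And>x y. x < n \<Longrightarrow> y < n \<Longrightarrow> labelling {..<n} (adj_in F (S x y)) (L x y)"
    by (auto simp: greedy_state_def)
  let ?rep = "rep (\<lambda>u v. of_bool ({u, v} \<in> F)) L"
  let ?c = "LIf (neq (Mem (at3 7 14 15 14)) (Mem (at3 7 14 15 15))) (LAssign 19 (Const 0)) LSkip"
  let ?P = "\<lambda>i j s. ?rep s \<and> (fst s 19 \<noteq> 0 \<longleftrightarrow>
     (\<forall>x<n. \<forall>y<n. x < i \<or> x = i \<and> y < j \<longrightarrow> L x y x = L x y y))"
  have "?P n 0 (sem (LFor 14 (LFor 15 ?c)) (set_reg 19 1 s))"
  proof (rule sem_LFor_induct[where P = "\<lambda>i. ?P i 0"])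
    fix i s1
    assume i: "i < n" "fst s1 14 = i" and s1: "?P i 0 s1"
    have n: "fst s1 1 = n" using s1 rep_reg by blast
    have "?P i n (sem (LFor 15 ?c) s1)"
    proof (rule sem_LFor_induct[where P = "\<lambda>j. ?P i j"])
      fix j s2
      assume j: "j < n" "fst s2 15 = j" and s2: "?P i j s2"
        and r2: "\<And>r. r \<notin> mods (LFor 15 ?c) \<Longrightarrow> fst s2 r = fst s1 r"
      have regs: "fst s2 14 = i" using i r2 by auto
      have val: "expr_val (Mem (at3 7 14 15 14)) s2 = L i j i" "expr_val (Mem (at3 7 14 15 15)) s2 = L i j j"
        using label_val[of "\<lambda>u v. of_bool ({u, v} \<in> F)" L s2 14 15] s2 regs i j by simp_all
      have "sem ?c s2 = (if L i j i = L i j j then s2 else set_reg 19 0 s2)" using val by simp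
      then show "?P i (Suc j) (set_reg 15 (Suc j) (sem ?c s2))"
        using s2 i j by (auto simp: rep_set_reg less_Suc_eq)
    qed (use s1 n in \<open>simp_all add: rep_set_reg\<close>)
    then show "?P (Suc i) 0 (set_reg 14 (Suc i) (sem (LFor 15 ?c) s1))"
      by (auto simp: rep_set_reg less_Suc_eq)
  qed (use rep rep_reg[OF rep] in \<open>auto simp: rep_set_reg\<close>)
  then show ?thesis using L by (auto simp: check_prog_def greedy_state_def labelling_def)
qed

end

section \<open>Setup: products by repeated addition, memory layout and multiplication tables\<close>

lemma accumulate_correct:
  assumes "fst s 1 = n" "i \<noteq> a" "i \<noteq> b" "i \<noteq> 1" "a \<noteq> b" "a \<noteq> 1"
  shows "fst (sem (LFor i (LAssign a (Add (Reg a) (Reg b)))) s) a = fst s a + n * fst s b"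
    and "snd (sem (LFor i (LAssign a (Add (Reg a) (Reg b)))) s) = snd s"
proof -
  let ?c = "LAssign a (Add (Reg a) (Reg b))"
  let ?P = "\<lambda>k s'. fst s' a = fst s a + k * fst s b \<and> snd s' = snd s"
  have "?P n (sem (LFor i ?c) s)"
  proof (rule sem_LFor_induct[where P = ?P])
    fix k s'
    assume "?P k s'" and r: "\<And>r. r \<notin> mods (LFor i ?c) \<Longrightarrow> fst s' r = fst s r"
    then show "?P (Suc k) (set_reg i (Suc k) (sem ?c s'))"
      using r[of b] assms by simp
  qed (use assms in auto)
  then show "fst (sem (LFor i ?c) s) a = fst s a + n * fst s b" "snd (sem (LFor i ?c) s) = snd s"
    by simp_all
qed

definition table_prog :: loop_prog where
  "table_prog = LFor 10 (LSeq (LStore (Add (Reg 8) (Reg 10)) (Reg 16))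
              (LSeq (LStore (Add (Reg 9) (Reg 10)) (Reg 17))
              (LSeq (LAssign 16 (Add (Reg 16) (Reg 1)))
                    (LAssign 17 (Add (Reg 17) (Reg 2))))))"

text \<open>The assumption on registers 8 and 9 puts the second table right behind the first, so
  their entries never collide.\<close>

lemma table_correct:
  assumes "fst s 1 = n" "fst s 2 = n * n" "fst s 16 = 0" "fst s 17 = 0" "fst s 9 = fst s 8 + n"
  shows "snd (sem table_prog s) = (\<lambda>i. if fst s 8 \<le> i \<and> i < fst s 8 + n then (i - fst s 8) * n
     else if fst s 9 \<le> i \<and> i < fst s 9 + n then (i - fst s 9) * (n * n) else snd s i)"
proof -
  let ?c = "LSeq (LStore (Add (Reg 8) (Reg 10)) (Reg 16))
              (LSeq (LStore (Add (Reg 9) (Reg 10)) (Reg 17))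
              (LSeq (LAssign 16 (Add (Reg 16) (Reg 1)))
                    (LAssign 17 (Add (Reg 17) (Reg 2)))))"
  let ?M = "\<lambda>k i. if fst s 8 \<le> i \<and> i < fst s 8 + k then (i - fst s 8) * n
     else if fst s 9 \<le> i \<and> i < fst s 9 + k then (i - fst s 9) * (n * n) else snd s i"
  let ?P = "\<lambda>k s'. fst s' 16 = k * n \<and> fst s' 17 = k * (n * n) \<and> snd s' = ?M k"
  have "?P n (sem (LFor 10 ?c) s)"
  proof (rule sem_LFor_induct[where P = ?P])
    fix k s'
    assume k: "k < n" "fst s' 10 = k" and s': "?P k s'"
      and r: "\<And>r. r \<notin> mods (LFor 10 ?c) \<Longrightarrow> fst s' r = fst s r"
    have regs: "fst s' 1 = n" "fst s' 2 = n * n" "fst s' 8 = fst s 8" "fst s' 9 = fst s 9"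
      using r assms by simp_all
    have "snd (sem ?c s') = (?M k)(fst s 8 + k := k * n, fst s 9 + k := k * (n * n))"
      using s' regs k by simp
    also have "\<dots> = ?M (Suc k)"
      using k assms(5) by (auto simp: fun_eq_iff)
    finally show "?P (Suc k) (set_reg 10 (Suc k) (sem ?c s'))"
      using s' regs by simp
  qed (use assms in auto)
  then show ?thesis by (simp add: table_prog_def)
qed

definition layout_prog :: loop_prog where
  "layout_prog =
    LSeq (LAssign 4 (Add (Reg 1) (Const 1)))
    (LSeq (LAssign 5 (Add (Reg 4) (Reg 2)))
    (LSeq (LAssign 6 (Add (Reg 5) (Reg 3)))
    (LSeq (LAssign 7 (Add (Reg 6) (Reg 2)))
    (LSeq (LAssign 8 (Add (Reg 7) (Reg 3)))
    (LSeq (LAssign 9 (Add (Reg 8) (Reg 1)))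
    (LSeq (LAssign 16 (Const 0)) (LAssign 17 (Const 0))))))))"

definition setup_prog :: loop_prog where
  "setup_prog = LSeq (LFor 10 (LAssign 2 (Add (Reg 2) (Reg 1))))
     (LSeq (LFor 10 (LAssign 3 (Add (Reg 3) (Reg 2)))) (LSeq layout_prog table_prog))"

definition main_prog :: loop_prog where
  "main_prog = LSeq setup_prog (LSeq init_prog (LSeq greedy_prog (LSeq check_prog output_prog)))"

context cc_run
begin

text \<open>The zeros beyond the input make the array of chosen edges empty; the zero labels are
  placeholders until \<open>init_prog\<close> runs.\<close>

lemma setup_correct:
  assumes regs: "fst s 1 = n" "fst s 2 = 0" "fst s 3 = 0"
    and E: "\<And>u v. u < n \<Longrightarrow> v < n \<Longrightarrow> snd s (n + 1 + idx2 n u v) = of_bool ({u, v} \<in> E)"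
    and S: "\<And>x y w. x < n \<Longrightarrow> y < n \<Longrightarrow> w < n \<Longrightarrow> snd s (n + 1 + n * n + idx3 n x y w) = of_bool (w \<in> S x y)"
    and zero: "\<And>i. n + 1 + n * n + n * (n * n) \<le> i \<Longrightarrow> snd s i = 0"
  shows "rep (\<lambda>u v. 0) (\<lambda>x y w. 0) (sem setup_prog s)"
proof -
  define s1 where "s1 = sem (LFor 10 (LAssign 2 (Add (Reg 2) (Reg 1)))) s"
  define s2 where "s2 = sem (LFor 10 (LAssign 3 (Add (Reg 3) (Reg 2)))) s1"
  define s3 where "s3 = sem layout_prog s2"
  have r1: "fst s1 r = fst s r" if "r \<notin> {2, 10}" for r
    unfolding s1_def by (rule sem_unmodified) (use that in simp)
  have s1: "fst s1 2 = n * n" "snd s1 = snd s" "fst s1 1 = n" "fst s1 3 = 0"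
    using accumulate_correct[OF regs(1), of 10 2 1, folded s1_def] regs r1 by simp_all
  have r2: "fst s2 r = fst s1 r" if "r \<notin> {3, 10}" for r
    unfolding s2_def by (rule sem_unmodified) (use that in simp)
  have s2: "fst s2 3 = n * (n * n)" "snd s2 = snd s" "fst s2 1 = n" "fst s2 2 = n * n"
    using accumulate_correct[OF s1(3), of 10 3 2, folded s2_def] s1 r2 by simp_all
  have s3: "regs_ok (fst s3)" "snd s3 = snd s" "fst s3 2 = n * n" "fst s3 16 = 0" "fst s3 17 = 0"
    using s2 by (simp_all add: s3_def layout_prog_def regs_ok_def)
  define s4 where "s4 = sem table_prog s3"
  have r4: "fst s4 r = fst s3 r" if "r \<notin> {10, 16, 17}" for r
    unfolding s4_def by (rule sem_unmodified) (use that in \<open>simp add: table_prog_def\<close>)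
  then have r4_8_9: "fst s4 8 = fst s3 8" "fst s4 9 = fst s3 9" by simp_all
  have regs4: "regs_ok (fst s4)" using s3(1) r4 by (simp add: regs_ok_def)
  have "fst s3 1 = n" "fst s3 9 = fst s3 8 + n" using s3(1) by (simp_all add: regs_ok_def)
  from table_correct[OF this(1) s3(3-5) this(2)]
  have M: "snd s4 = (\<lambda>i. if fst s4 8 \<le> i \<and> i < fst s4 8 + n then (i - fst s4 8) * n
     else if fst s4 9 \<le> i \<and> i < fst s4 9 + n then (i - fst s4 9) * (n * n) else snd s i)"
    unfolding s4_def[symmetric] s3(2) by (simp only: r4_8_9)
  have low: "snd s4 i = snd s i" if "i < fst s4 8" for i
    using that regs4 by (simp add: M regs_ok_def)
  have "snd s4 (fst s4 8 + u) = u * n" "snd s4 (fst s4 9 + u) = u * (n * n)" if "u < n" for u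
    using that regs4 by (auto simp: M regs_ok_def)
  moreover have "snd s4 (fst s4 4 + idx2 n u v) = of_bool ({u, v} \<in> E)" if "u < n" "v < n" for u v
    using low[of "fst s4 4 + idx2 n u v"] regs4 idx2_bound[OF that] E[OF that] by (simp add: regs_ok_def)
  moreover have "snd s4 (fst s4 5 + idx3 n x y w) = of_bool (w \<in> S x y)" if "x < n" "y < n" "w < n" for x y w
    using low[of "fst s4 5 + idx3 n x y w"] regs4 idx3_bound[OF that] S[OF that] by (simp add: regs_ok_def)
  moreover have "snd s4 (fst s4 6 + idx2 n u v) = 0" if "u < n" "v < n" for u v
    using low[of "fst s4 6 + idx2 n u v"] regs4 idx2_bound[OF that] zero by (simp add: regs_ok_def)
  moreover have "snd s4 (fst s4 7 + idx3 n x y w) = 0" if "x < n" "y < n" "w < n" for x y w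
    using low[of "fst s4 7 + idx3 n x y w"] regs4 idx3_bound[OF that] zero by (simp add: regs_ok_def)
  ultimately have "rep (\<lambda>u v. 0) (\<lambda>x y w. 0) s4"
    using regs4 by (simp add: rep_def)
  then show ?thesis by (simp add: setup_prog_def s4_def s3_def s2_def s1_def)
qed

section \<open>Output and correctness of the whole program\<close>

lemma output_success:
  assumes state: "greedy_state F s" and flag: "fst s 19 \<noteq> 0"
  shows "output_of (sem output_prog s) (True # adj_bits n F)"
proof -
  from state obtain L where rep: "rep (\<lambda>u v. of_bool ({u, v} \<in> F)) L s"
    by (auto simp: greedy_state_def)
  have n: "fst s 1 = n" by (rule rep_reg[OF rep])
  let ?copied = "\<lambda>p s'. fst s' 20 = p \<and>
     snd s' = (\<lambda>a. if 1 \<le> a \<and> a \<le> p then snd s (fst s 6 + (a - 1)) else snd s a)"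
  let ?c = "LSeq (LStore (Add (Reg 20) (Const 1)) (Mem (Add (Reg 6) (Reg 20))))
          (LAssign 20 (Add (Reg 20) (Const 1)))"
  \<comment> \<open>With a positive base, the source cell \<open>fst s 6 + q\<close> lies beyond the
    cells 1 to \<open>q\<close> written so far, so it still holds its original value.\<close>
  have R6: "0 < fst s 6" using rep by (simp add: rep_def regs_ok_def)
  define s' where "s' = sem (LFor 14 (LFor 15 ?c)) (set_reg 20 0 s)"
  have "?copied (n * n) s'"
    unfolding s'_def
  proof (rule sem_LFor_induct[where P = "\<lambda>i. ?copied (i * n)"])
    fix i s1
    assume i: "i < n" "fst s1 14 = i" and s1: "?copied (i * n) s1"
      and r1: "\<And>r. r \<notin> mods (LFor 14 (LFor 15 ?c)) \<Longrightarrow> fst s1 r = fst (set_reg 20 0 s) r"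
    have "?copied (i * n + n) (sem (LFor 15 ?c) s1)"
    proof (rule sem_LFor_induct[where P = "\<lambda>j. ?copied (i * n + j)"])
      fix j s2
      assume s2: "?copied (i * n + j) s2"
        and r2: "\<And>r. r \<notin> mods (LFor 15 ?c) \<Longrightarrow> fst s2 r = fst s1 r"
      define q where "q = i * n + j"
      have q: "i * n + Suc j = Suc q" and s2: "?copied q s2" using s2 by (simp_all add: q_def)
      have 6: "fst s2 6 = fst s 6" using r1 r2 by simp
      have c: "sem ?c s2 = set_reg 20 (Suc q) (fst s2, (snd s2)(Suc q := snd s (fst s 6 + q)))"
        using s2 6 R6 by simp
      show "?copied (i * n + Suc j) (set_reg 15 (Suc j) (sem ?c s2))"
        unfolding c q using s2 by (auto simp: fun_eq_iff le_Suc_eq)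
    qed (use s1 r1 n in auto)
    then show "?copied (Suc i * n) (set_reg 14 (Suc i) (sem (LFor 15 ?c) s1))"
      by (simp add: add.commute)
  qed (use n in auto)
  moreover have "sem output_prog s = set_reg 0 (fst s' 20 + 1) (fst s', (snd s')(0 := 1))"
    using flag by (simp add: output_prog_def s'_def)
  moreover have "snd s (fst s 6 + m) = of_bool (adj_bits n F ! m)" if "m < n * n" for m
  proof -
    \<comment> \<open>Row and column are recovered by division by \<open>n\<close>, which is nonzero
      because a cell \<open>m\<close> exists.\<close>
    have "0 < n" using that by (cases n) auto
    then have uv: "m div n < n" "m mod n < n" "idx2 n (m div n) (m mod n) = m"
      using that by (auto simp: idx2_def less_mult_imp_div_less)
    have "snd s (fst s 6 + idx2 n (m div n) (m mod n)) = of_bool ({m div n, m mod n} \<in> F)"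
      using rep uv(1,2) unfolding rep_def by blast
    then show ?thesis using nth_adj_bits[OF uv(1,2), of F] by (simp add: uv(3))
  qed
  ultimately show ?thesis
    by (auto simp: output_of_def length_adj_bits nth_Cons split: nat.split)
qed

lemma output_failure:
  "fst s 19 = 0 \<Longrightarrow> output_of (sem output_prog s) [False]"
  by (simp add: output_prog_def output_of_def)

text \<open>The flag states feasibility of the greedy result. It decides whether any solution
  exists, because by \<open>greedy_optimal\<close> one feasible subgraph makes that result
  feasible.\<close>

lemma main_correct:
  assumes "fst s 1 = n" "fst s 2 = 0" "fst s 3 = 0"
    and "\<And>u v. u < n \<Longrightarrow> v < n \<Longrightarrow> snd s (n + 1 + idx2 n u v) = of_bool ({u, v} \<in> E)"
    and "\<And>x y w. x < n \<Longrightarrow> y < n \<Longrightarrow> w < n \<Longrightarrow> snd s (n + 1 + n * n + idx3 n x y w) = of_bool (w \<in> S x y)"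
    and "\<And>i. n + 1 + n * n + n * (n * n) \<le> i \<Longrightarrow> snd s i = 0"
  shows "\<exists>y. output_of (sem main_prog s) y \<and> cc_sum_answer (n, E, S) y"
proof -
  let ?F = "greedy [0..<n]"
  have "labelling {..<n} (adj_in {} A) (\<lambda>w. w)" for A
    by (simp add: labelling_def adj_in_def)
  then have "greedy_state {} (sem init_prog (sem setup_prog s))"
    using init_correct[OF setup_correct[OF assms]] by (auto simp: greedy_state_def)
  from greedy_prog_correct[OF this] check_correct
  have state: "greedy_state ?F (sem check_prog (sem greedy_prog (sem init_prog (sem setup_prog s))))"
    and flag: "fst (sem check_prog (sem greedy_prog (sem init_prog (sem setup_prog s)))) 19 \<noteq> 0 \<longleftrightarrow>
      feasible ({..<n}, E) S ({..<n}, ?F)"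
    using greedy_subset by (auto simp: feasible_iff)
  show ?thesis
  proof (cases "\<exists>H. feasible ({..<n}, E) S H")
    case True
    then have opt: "optimal ({..<n}, E) S ({..<n}, ?F)" using greedy_optimal by force
    then have "feasible ({..<n}, E) S ({..<n}, ?F)" by (simp add: optimal_def is_arg_min_def)
    then have "output_of (sem main_prog s) (True # adj_bits n ?F)"
      using output_success[OF state] flag by (simp add: main_prog_def)
    moreover have "cc_sum_answer (n, E, S) (True # adj_bits n ?F)"
      using True opt by (force simp: cc_sum_answer_def)
    ultimately show ?thesis by blast
  next
    case False
    then have "output_of (sem main_prog s) [False]"
      using output_failure flag by (simp add: main_prog_def)
    then show ?thesis using False by (auto simp: cc_sum_answer_def)
  qed
qed

end

section \<open>Reading the input\<close>

definition parse_prog :: prog where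
  "parse_prog = While (Mem (Reg 1)) (Assign 1 (Add (Reg 1) (Const 1)))"

text \<open>Register 1, later the loop bound, is itself the scanning address and stops at the
  separator. Each unary digit costs a test of 3 steps and an increment of 4; the final test costs
  3.\<close>

lemma parse_exec:
  assumes "\<And>i. i < n \<Longrightarrow> snd s i \<noteq> 0" "snd s n = 0" "k \<le> n"
  shows "exec parse_prog (set_reg 1 k s) (7 * (n - k) + 3) (set_reg 1 n s)"
  using assms(3)
proof (induction k rule: inc_induct)
  case base
  have "exec parse_prog (set_reg 1 n s) (expr_cost (Mem (Reg 1)) + 1) (set_reg 1 n s)"
    unfolding parse_prog_def by (rule exec.WhileFalse) (simp add: assms)
  then show ?case by (simp add: numeral_eq_Suc)
next
  case (step k)
  let ?c = "Assign 1 (Add (Reg 1) (Const 1))"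
  have "exec ?c (set_reg 1 k s) 4 (set_reg 1 (Suc k) s)"
    using exec.Assign[of 1 "Add (Reg 1) (Const 1)" "set_reg 1 k s"]
    by (simp add: set_reg_def numeral_eq_Suc)
  from exec.WhileTrue[OF _ this step.IH[unfolded parse_prog_def]] assms(1)[of k] step.hyps
  have "exec parse_prog (set_reg 1 k s) (expr_cost (Mem (Reg 1)) + 1 + 4 + (7 * (n - Suc k) + 3)) (set_reg 1 n s)"
    unfolding parse_prog_def by simp
  moreover have "expr_cost (Mem (Reg 1)) + 1 + 4 + (7 * (n - Suc k) + 3) = 7 * (n - k) + 3"
    using step.hyps by simp
  ultimately show ?case by (simp only:)
qed

lemma cc_encode_layout:
  fixes n E S
  defines "x \<equiv> cc_encode (n, E, S)"
  shows "length x = n + 1 + n * n + n * (n * n)"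
    and "i < n \<Longrightarrow> x ! i" and "\<not> x ! n"
    and "u < n \<Longrightarrow> v < n \<Longrightarrow> x ! (n + 1 + idx2 n u v) = ({u, v} \<in> E)"
    and "a < n \<Longrightarrow> b < n \<Longrightarrow> w < n \<Longrightarrow> x ! (n + 1 + n * n + idx3 n a b w) = (w \<in> S a b)"
  using idx2_bound[of u n v]
  by (simp_all add: x_def cc_encode_def length_adj_bits length_safe_bits nth_append nth_adj_bits nth_safe_bits)

theorem theorem28:
  "poly_time_solvable sym_hier_instances cc_encode cc_sum_answer"
  unfolding poly_time_solvable_def
proof (rule exI[of _ "Seq parse_prog (compile main_prog)"], rule exI[of _ "[:3, 7:] + time_poly main_prog"],
    rule ballI)
  let ?prog = "Seq parse_prog (compile main_prog)"
  let ?p = "[:3, 7:] + time_poly main_prog"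
  fix i assume "i \<in> sym_hier_instances"
  then obtain n E S where i: "i = (n, E, S)" and "cc_run n E S"
    by (auto simp: sym_hier_instances_def cc_run_def sym_hier_safe_def)
  then interpret cc_run n E S by simp
  define x where "x = cc_encode i"
  note layout = cc_encode_layout[where n = n and E = E and S = S, folded i x_def]
  let ?s = "input_state x"
  define s1 where "s1 = set_reg 1 n ?s"
  have x_len: "n + 1 + idx2 n u v < length x" if "u < n" "v < n" for u v
    using layout(1) idx2_bound[OF that] by simp
  have x_len': "n + 1 + n * n + idx3 n a b w < length x" if "a < n" "b < n" "w < n" for a b w
    using layout(1) idx3_bound[OF that] by simp
  have "exec parse_prog (set_reg 1 0 ?s) (7 * (n - 0) + 3) (set_reg 1 n ?s)"
    by (rule parse_exec) (use layout(1-3) in \<open>auto simp: input_state_def\<close>)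
  moreover have "set_reg 1 0 ?s = ?s"
    by (auto simp: set_reg_def input_state_def)
  ultimately have parse: "exec parse_prog ?s (7 * n + 3) s1" by (simp add: s1_def)
  have "well_formed main_prog"
    by (simp add: main_prog_def prog_defs table_prog_def layout_prog_def setup_prog_def)
  from compile_correct[OF this, of s1] obtain t where
    t: "exec (compile main_prog) s1 t (sem main_prog s1)" "t \<le> poly (time_poly main_prog) n"
    by (auto simp: s1_def)
  have "\<exists>y. output_of (sem main_prog s1) y \<and> cc_sum_answer (n, E, S) y"
    by (rule main_correct)
      (use layout x_len x_len' in \<open>simp_all add: s1_def input_state_def\<close>)
  then obtain y where y: "output_of (sem main_prog s1) y" "cc_sum_answer i y" by (auto simp: i)
  have "runs ?prog x (7 * n + 3 + t) y"
    unfolding runs_def using exec.Seq[OF parse t(1)] y(1) by blast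
  moreover have "7 * n + 3 + t \<le> poly ?p (length x)"
  proof -
    have "7 * n + 3 + t \<le> poly ?p n" using t(2) by simp
    \<comment> \<open>The number of vertices is written in unary, so \<open>n\<close> is at most the
      input length and a polynomial in \<open>n\<close> is bounded by one in that length.\<close>
    also have "\<dots> \<le> poly ?p (length x)" by (rule poly_mono_nat) (simp add: layout(1))
    finally show ?thesis .
  qed
  ultimately show "\<exists>t y. runs ?prog (cc_encode i) t y \<and> t \<le> poly ?p (length (cc_encode i)) \<and> cc_sum_answer i y"
    using y(2) unfolding x_def by blast
qed

end
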